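(* Let $f_a:\mathbb R^3\to\mathbb R^3$, $f_a(x)=F(x)-(0,0,a)$, be a Zorich map whose parameter $a\in\mathbb R$ satisfies $a\geq e^M-m$, let $\xi=(\xi_1,\xi_2,\xi_3)$ be its unique fixed point with $\xi_3\le m$, and let $$J:=\{x\in\mathbb R^3:\ f_a^k(x)\not\to\xi \text{ as } k\to\infty\}.$$ Then all points of $J$ are accessible from $\mathbb R^3\setminus J$.
   Context: Zorich maps. Let $Q=\{(x_1,x_2)\in\mathbb R^2: |x_1|\le 1, |x_2|\le 1\}$ and $U=\{x\in\mathbb R^3: x_1^2+x_2^2+x_3^2=1,\ x_3\ge 0\}$, and let $h=(h_1,h_2,h_3):Q\to U$ be a bilipschitz homeomorphism onto $U$ (so $h$ maps $\partial Q$ onto $\{x\in U:x_3=0\}$). Define $F(x_1,x_2,x_3)=e^{x_3}h(x_1,x_2)$ on $Q\times\mathbb R$, and extend $F$ to $\mathbb R^3$ by repeated reflection in the sides of the square beams in the domain and in the $(x_1,x_2)$-plane in the range. Explicitly, let $\varphi:\mathbb R\to[-1,1]$ be the $4$-periodic function with $\varphi(u)=u$ for $-1\le u\le 1$ and $\varphi(u)=2-u$ for $1\le u\le 3$; if $r_1,r_2\in\mathbb Z$ and $|x_1-2r_1|\le 1$, $|x_2-2r_2|\le 1$, then $F(x)=e^{x_3}\big(h_1(p),h_2(p),(-1)^{r_1+r_2}h_3(p)\big)$ with $p=(\varphi(x_1),\varphi(x_2))$. The map $F$ is differentiable a.e. Write $|DF(x)|=\sup_{|v|=1}|DF(x)v|$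 and $\ell(DF(x))=\inf_{|v|=1}|DF(x)v|$. Real numbers $\alpha,m,M$ with $0<\alpha<1$ and $m<M$ (such numbers exist) are fixed such that $|DF(x)|\le\alpha$ for a.e. $x$ with $x_3\le m$, and $\ell(DF(x))\ge 1/\alpha$ for a.e. $x$ with $x_3\ge M$. A point $x\in J$ is accessible from $\mathbb R^3\setminus J$ if there is a continuous curve $\gamma:[0,1]\to\mathbb R^3$ with $\gamma([0,1))\subset\mathbb R^3\setminus J$ and $\gamma(1)=x$. $f_a^k$ denotes the $k$-th iterate. *)

theory Defs
  imports "HOL-Analysis.Analysis"
begin

definition square :: "(real^2) set" where
  "square = {x. \<bar>x $ 1\<bar> \<le> 1 \<and> \<bar>x $ 2\<bar> \<le> 1}"

definition upper_hemisphere :: "(real^3) set" where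
  "upper_hemisphere = {x. (x $ 1)^2 + (x $ 2)^2 + (x $ 3)^2 = 1 \<and> x $ 3 \<ge> 0}"

definition bilipschitz_on :: "'a::metric_space set \<Rightarrow> ('a \<Rightarrow> 'b::metric_space) \<Rightarrow> bool" where
  "bilipschitz_on S f \<longleftrightarrow>
     (\<exists>L\<ge>1. \<forall>x\<in>S. \<forall>y\<in>S. dist x y / L \<le> dist (f x) (f y) \<and> dist (f x) (f y) \<le> L * dist x y)"

text \<open>The 4-periodic triangle wave with value \<open>u\<close> on \<open>[-1, 1]\<close> and \<open>2 - u\<close> on \<open>[1, 3]\<close>.
  The shift below moves \<open>u\<close> into \<open>[-1, 3)\<close>.\<close>

definition fold_wave :: "real \<Rightarrow> real" where
  "fold_wave u = (let v = u - 4 * of_int \<lfloor>(u + 1) / 4\<rfloor> in if v \<le> 1 then v else 2 - v)"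

text \<open>The index \<open>r\<close> of a beam, \<open>\<bar>u - 2 * r\<bar> \<le> 1\<close>; for odd \<open>u\<close> there are two such \<open>r\<close>
  and this takes the larger one. The choice is immaterial: on the faces of the beams the third
  component of \<open>h\<close> vanishes, see \<open>zorich_F_eq\<close> below.\<close>

definition beam_index :: "real \<Rightarrow> int" where
  "beam_index u = \<lfloor>(u + 1) / 2\<rfloor>"

definition zorich_F :: "(real^2 \<Rightarrow> real^3) \<Rightarrow> real^3 \<Rightarrow> real^3" where
  "zorich_F h x =
     (let p = vector [fold_wave (x $ 1), fold_wave (x $ 2)] in
      exp (x $ 3) *\<^sub>R
        vector [h p $ 1, h p $ 2, (-1) powi (beam_index (x $ 1) + beam_index (x $ 2)) * h p $ 3])"

definition zorich_map :: "(real^2 \<Rightarrow> real^3) \<Rightarrow> real \<Rightarrow> real^3 \<Rightarrow> real^3" where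
  "zorich_map h a x = zorich_F h x - vector [0, 0, a]"

text \<open>The minimal stretch; the maximal stretch is \<^const>\<open>onorm\<close>.\<close>

definition min_stretch :: "('a::real_normed_vector \<Rightarrow> 'b::real_normed_vector) \<Rightarrow> real" where
  "min_stretch T = (INF v\<in>sphere 0 1. norm (T v))"

definition non_attracted :: "('a::topological_space \<Rightarrow> 'a) \<Rightarrow> 'a \<Rightarrow> 'a set" where
  "non_attracted f \<xi> = {x. \<not> (\<lambda>k. (f ^^ k) x) \<longlonglongrightarrow> \<xi>}"

definition accessible_from :: "'a::topological_space set \<Rightarrow> 'a \<Rightarrow> bool" where
  "accessible_from S x \<longleftrightarrow> (\<exists>\<gamma>. path \<gamma> \<and> \<gamma> ` {0..<1} \<subseteq> S \<and> pathfinish \<gamma> = x)"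


lemma fold_wave_periodic: "fold_wave (u + 4) = fold_wave u"
proof -
  have "\<lfloor>(u + 4 + 1) / 4\<rfloor> = \<lfloor>(u + 1) / 4\<rfloor> + 1"
    unfolding floor_eq_iff using floor_correct[of "(u + 1) / 4"] by (simp add: field_simps)
  then show ?thesis
    by (simp add: fold_wave_def Let_def algebra_simps)
qed

lemma fold_wave_eq:
  assumes "\<bar>u - 2 * of_int r\<bar> \<le> 1"
  shows "fold_wave u = (-1) powi r * (u - 2 * of_int r)"
proof (cases "even r")
  case True
  then obtain k where k: "r = 2 * k" by blast
  have "\<lfloor>(u + 1) / 4\<rfloor> = k"
    using assms k by (auto simp: floor_eq_iff field_simps abs_le_iff)
  then show ?thesis
    using assms k by (auto simp: fold_wave_def Let_def power_int_minus_left)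
next
  case False
  then obtain k where k: "r = 2 * k + 1" by (auto elim: oddE)
  show ?thesis
  proof (cases "u = 4 * of_int k + 3")
    case True
    then have "\<lfloor>(u + 1) / 4\<rfloor> = k + 1"
      by (auto simp: floor_eq_iff field_simps)
    then show ?thesis
      using k True by (auto simp: fold_wave_def Let_def power_int_minus_left)
  next
    case F2: False
    then have "\<lfloor>(u + 1) / 4\<rfloor> = k"
      using assms k by (auto simp: floor_eq_iff field_simps abs_le_iff)
    then show ?thesis
      using assms k F2 by (auto simp: fold_wave_def Let_def power_int_minus_left abs_le_iff)
  qed
qed

lemma fold_wave_id: "-1 \<le> u \<Longrightarrow> u \<le> 1 \<Longrightarrow> fold_wave u = u"
  using fold_wave_eq[of u 0] by simp

lemma fold_wave_reflect: "1 \<le> u \<Longrightarrow> u \<le> 3 \<Longrightarrow> fold_wave u = 2 - u"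
  using fold_wave_eq[of u 1] by simp

lemma beam_index_cases:
  assumes "\<bar>u - 2 * of_int r\<bar> \<le> 1"
  shows "beam_index u = r \<or> \<bar>fold_wave u\<bar> = 1"
proof (cases "u = 2 * of_int r + 1")
  case True
  then show ?thesis using fold_wave_eq[OF assms] by (simp add: power_int_minus_left)
next
  case False
  then have "beam_index u = r"
    using assms by (auto simp: beam_index_def floor_eq_iff field_simps abs_le_iff)
  then show ?thesis ..
qed

lemma abs_fold_wave_le: "\<bar>fold_wave u\<bar> \<le> 1"
proof -
  have "\<bar>u - 2 * of_int (beam_index u)\<bar> \<le> 1"
    unfolding beam_index_def using floor_correct[of "(u + 1) / 2"]
    by (simp add: abs_le_iff field_simps)
  from fold_wave_eq[OF this] this show ?thesis
    by (auto simp: abs_mult power_int_minus_left)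
qed

lemma bilipschitz_on_homeomorphism:
  assumes "bilipschitz_on S f"
  shows "homeomorphism S (f ` S) f (inv_into S f)"
proof -
  obtain L where L: "L \<ge> 1"
    and lo: "\<And>x y. x \<in> S \<Longrightarrow> y \<in> S \<Longrightarrow> dist x y \<le> L * dist (f x) (f y)"
    and up: "\<And>x y. x \<in> S \<Longrightarrow> y \<in> S \<Longrightarrow> dist (f x) (f y) \<le> L * dist x y"
    using assms by (auto simp: bilipschitz_on_def field_simps)
  have inj: "inj_on f S"
    using lo by (fastforce intro: inj_onI)
  have "L-lipschitz_on S f"
    using L up by (auto intro!: lipschitz_onI)
  moreover have "L-lipschitz_on (f ` S) (inv_into S f)"
    using L lo inj by (auto intro!: lipschitz_onI)
  ultimately show ?thesis
    using inj by (auto simp: homeomorphism_def image_image intro: lipschitz_on_continuous_on)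
qed

lemma equator_of_side:
  assumes h: "bilipschitz_on square h" "h ` square = upper_hemisphere"
    and p: "p \<in> square" "\<bar>p $ 1\<bar> = 1 \<or> \<bar>p $ 2\<bar> = 1"
  shows "h p $ 3 = 0"
proof (rule ccontr)
  assume nz: "h p $ 3 \<noteq> 0"
  define g where "g = inv_into square h"
  define s :: "real^2 \<Rightarrow> real^3" where
    "s y = vector [y $ 1, y $ 2, sqrt (1 - (y $ 1)^2 - (y $ 2)^2)]" for y
  define D :: "(real^2) set" where "D = {y. (y $ 1)^2 + (y $ 2)^2 < 1}"
  have hom: "homeomorphism square upper_hemisphere h g"
    using bilipschitz_on_homeomorphism[OF h(1)] h(2) by (simp add: g_def)
  have "D = (\<lambda>y. (y $ 1)^2 + (y $ 2)^2) -` {..<1}"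
    by (auto simp: D_def)
  then have "open D"
    by (auto intro!: open_vimage continuous_intros)
  have sU: "s ` D \<subseteq> upper_hemisphere"
  proof
    fix z assume "z \<in> s ` D"
    then obtain y where "y \<in> D" "z = s y" by blast
    then show "z \<in> upper_hemisphere"
      by (simp add: s_def D_def upper_hemisphere_def)
  qed
  have "continuous_on D (\<lambda>y. s y $ i)" for i
    using exhaust_3[of i] by (elim disjE) (simp_all add: s_def, (intro continuous_intros)+)
  then have "continuous_on D (\<lambda>y. \<chi> i. s y $ i)"
    by (intro continuous_on_vec_lambda)
  then have "continuous_on D s"
    by simp
  moreover have "continuous_on (s ` D) g"
    using hom sU by (meson homeomorphism_def continuous_on_subset)
  ultimately have cont: "continuous_on D (g \<circ> s)"
    by (rule continuous_on_compose)
  have "inj_on s D"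
    by (auto simp: inj_on_def s_def vec_eq_iff forall_2 forall_3)
  moreover have "inj_on g upper_hemisphere"
    using hom by (metis homeomorphism_def inj_on_inverseI)
  ultimately have "inj_on (g \<circ> s) D"
    using sU by (auto intro: comp_inj_on inj_on_subset)
  with cont \<open>open D\<close> have op: "open ((g \<circ> s) ` D)"
    by (rule invariance_of_domain)
  have sub: "(g \<circ> s) ` D \<subseteq> square"
    unfolding image_comp[symmetric] using hom image_mono[OF sU, of g]
    by (simp add: homeomorphism_def)
  have hp: "h p \<in> upper_hemisphere"
    using p h by auto
  define y :: "real^2" where "y = vector [h p $ 1, h p $ 2]"
  have pos: "(h p $ 3)^2 > 0" using nz by simp
  have e: "1 - (h p $ 1)^2 - (h p $ 2)^2 = (h p $ 3)^2"
    using hp by (simp add: upper_hemisphere_def)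
  have "(h p $ 1)^2 + (h p $ 2)^2 < 1"
    using e pos by linarith
  then have "y \<in> D"
    by (simp add: y_def D_def)
  moreover have "s y = h p"
    using e hp by (simp add: s_def y_def vec_eq_iff forall_3 upper_hemisphere_def)
  moreover have "g (h p) = p"
    using hom p by (simp add: homeomorphism_def)
  ultimately have "p \<in> (g \<circ> s) ` D"
    by force
  then obtain e where e: "e > 0" "ball p e \<subseteq> square"
    using op sub by (meson open_contains_ball order_trans)
  define q where "q = (1 + e / (2 * (norm p + 1))) *\<^sub>R p"
  have n: "norm p + 1 > 0" by (simp add: add_nonneg_pos)
  have "dist p q = e / 2 * (norm p / (norm p + 1))"
    using e n by (simp add: q_def dist_norm algebra_simps)
  also have "\<dots> \<le> e / 2 * 1"
    using e n by (intro mult_left_mono) auto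
  also have "\<dots> < e"
    using e by simp
  finally have "q \<in> square" using e by auto
  moreover have "1 + e / (2 * (norm p + 1)) > 1"
    using e n by simp
  ultimately show False
    using p(2) by (auto simp: square_def q_def abs_mult)
qed

text \<open>The defining formula holds for every admissible pair of beam indices, so
  \<^const>\<open>zorich_F\<close> does not depend on the choice made in \<^const>\<open>beam_index\<close>.\<close>

lemma zorich_F_eq:
  fixes x :: "real^3"
  assumes h: "bilipschitz_on square h" "h ` square = upper_hemisphere"
    and r: "\<bar>x $ 1 - 2 * of_int r1\<bar> \<le> 1" "\<bar>x $ 2 - 2 * of_int r2\<bar> \<le> 1"
  defines "p \<equiv> vector [fold_wave (x $ 1), fold_wave (x $ 2)]"
  shows "zorich_F h x = exp (x $ 3) *\<^sub>R vector [h p $ 1, h p $ 2, (-1) powi (r1 + r2) * h p $ 3]"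
proof -
  have "p \<in> square"
    by (simp add: p_def square_def abs_fold_wave_le)
  have "(beam_index (x $ 1) = r1 \<and> beam_index (x $ 2) = r2) \<or> \<bar>p $ 1\<bar> = 1 \<or> \<bar>p $ 2\<bar> = 1"
    using beam_index_cases[OF r(1)] beam_index_cases[OF r(2)] by (auto simp: p_def)
  then have "(beam_index (x $ 1) = r1 \<and> beam_index (x $ 2) = r2) \<or> h p $ 3 = 0"
    using equator_of_side[OF h \<open>p \<in> square\<close>] by blast
  then show ?thesis
    by (auto simp: zorich_F_def p_def Let_def)
qed

end

theory Submission
  imports Defs
begin

text \<open>
  A point is not attracted to \<open>\<xi>\<close> iff its orbit stays above height \<open>M\<close>. Such an orbit runs through
  beams that \<open>F\<close> maps onto the upper half-space, and on these beams \<open>f\<close> has inverse branches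
  that contract by \<open>\<alpha>\<close> above height \<open>M\<close>. The walls of the beams are attracted, because \<open>F\<close> maps
  them into the plane \<open>x\<^sub>3 = 0\<close>.

  Let \<open>x\<close> be in \<open>J\<close>, let \<open>z\<close> be a point near \<open>x\<close> on the wall of its beam and \<open>z'\<close> a point near \<open>f x\<close> on the
  wall of its beam, at the same heights. Rotating \<open>z' + (0, 0, a)\<close> inside the plane of the wall (which
  keeps the norm) down to \<open>x\<^sub>3 = 0\<close>, and continuing in the plane \<open>x\<^sub>3 = 0\<close> to \<open>F z\<close>, gives a curve
  whose preimage joins the preimage of \<open>z'\<close> to \<open>z\<close> outside \<open>J\<close>. As \<open>\<bar>F y\<bar> = exp y\<^sub>3\<close>, this preimage
  stays within a bounded distance of \<open>x\<close>. Pulling back these curves for all \<open>f\<^sup>k x\<close> along the orbit gives a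
  chain of curves of diameters \<open>O(\<alpha>\<^sup>k)\<close> that converges to \<open>x\<close>.
\<close>

section \<open>Lipschitz constants from almost everywhere derivative bounds\<close>

text \<open>Averaging \<open>u\<close> over a small box makes it differentiable along \<open>v\<close> everywhere, by dominated
  convergence, so that the mean value theorem applies to the averages.\<close>

lemma increment_le_of_AE_derivative_le:
  fixes u :: "'a::euclidean_space \<Rightarrow> real"
  assumes S: "open S" "convex S" and lip: "L-lipschitz_on S u" and N: "negligible N"
    and der: "\<And>z. z \<in> S - N \<Longrightarrow> \<exists>D. (u has_derivative D) (at z) \<and> D v \<le> K"
    and x: "x \<in> S" "x + v \<in> S"
  shows "u (x + v) - u x \<le> K"
proof (rule field_le_epsilon)
  fix e :: real assume e: "e > 0"
  have L: "L \<ge> 0" using lip by (rule lipschitz_on_nonneg)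
  have lipD: "\<bar>u y - u z\<bar> \<le> L * norm (y - z)" if "y \<in> S" "z \<in> S" for y z
    using lipschitz_onD[OF lip that] by (simp add: dist_norm)
  \<comment> \<open>Moving both end points of the increment by less than \<open>\<rho>\<close>
    changes it by at most \<open>2 * L * \<rho>\<close>, hence by at most \<open>e\<close>; the
    summand 1 covers the case \<open>L = 0\<close>.\<close>
  define \<rho> where "\<rho> = e / (2 * (L + 1))"
  have \<rho>: "\<rho> > 0" "2 * L * \<rho> \<le> e"
    using e L by (auto simp: \<rho>_def field_simps)
  define A where "A = S \<inter> (\<lambda>z. z + v) -` S \<inter> ball x \<rho>"
  have "open A"
    unfolding A_def using S by (intro open_Int open_vimage continuous_intros) auto
  moreover have "x \<in> A" using x \<rho> by (simp add: A_def)
  ultimately obtain c d where cd: "cbox c d \<subseteq> A" "x \<in> box c d" "\<forall>i\<in>Basis. c \<bullet> i < d \<bullet> i"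
    by (rule open_contains_cbox)
  let ?B = "cbox c d"
  have pos: "measure lborel ?B > 0"
    using cd(3) by (simp add: content_pos_lt)
  have tube: "z + t *\<^sub>R v \<in> S" if "z \<in> ?B" "t \<in> {0..1}" for z t
  proof -
    have "(1 - t) *\<^sub>R z + t *\<^sub>R (z + v) \<in> S"
      using that cd(1) by (intro convexD[OF S(2)]) (auto simp: A_def)
    then show ?thesis by (simp add: algebra_simps)
  qed
  have cont: "continuous_on ?B (\<lambda>z. u (z + t *\<^sub>R v))" if "t \<in> {0..1}" for t
    using that tube
    by (intro continuous_on_compose2[OF lipschitz_on_continuous_on[OF lip]] continuous_intros) auto
  have int: "(\<lambda>z. u (z + t *\<^sub>R v)) integrable_on ?B" if "t \<in> {0..1}" for t
    using integrable_continuous[OF cont[OF that]] .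
  define \<Phi> where "\<Phi> t = integral ?B (\<lambda>z. u (z + t *\<^sub>R v))" for t
  have "\<exists>d. (\<Phi> has_real_derivative d) (at t within {0..1}) \<and> d \<le> measure lborel ?B * K"
    if t: "t \<in> {0..1}" for t
  proof -
    define Nt where "Nt = (+) (- t *\<^sub>R v) ` N"
    have Nt: "negligible Nt"
      unfolding Nt_def using N by (rule negligible_translation)
    have notN: "z + t *\<^sub>R v \<notin> N" if "z \<notin> Nt" for z
      using that by (force simp: Nt_def image_iff)
    have "\<forall>z\<in>S - N. \<exists>D. (u has_derivative D) (at z) \<and> D v \<le> K" using der by blast
    then obtain D where D: "\<And>z. z \<in> S - N \<Longrightarrow> (u has_derivative D z) (at z)"
      and DK: "\<And>z. z \<in> S - N \<Longrightarrow> D z v \<le> K"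
      by metis
    \<comment> \<open>On the null set \<open>Nt\<close> the derivative may fail to exist. The value
      \<open>K\<close> there does not affect the integral and lets \<open>w z \<le> K\<close> hold
      on the whole box.\<close>
    define w where "w z = (if z \<in> Nt then K else D (z + t *\<^sub>R v) v)" for z
    \<comment> \<open>Dominated convergence is about sequences, so the difference quotient of
      \<open>\<Phi>\<close> is treated along an arbitrary sequence \<open>X\<close> in the interval
      that tends to \<open>t\<close>.\<close>
    have lim: "((\<lambda>s. (\<Phi> s - \<Phi> t) / (s - t)) \<circ> X) \<longlonglongrightarrow> integral ?B w" and wint: "w integrable_on ?B"
      if X: "\<forall>i. X i \<in> {0..1} - {t}" "X \<longlonglongrightarrow> t" for X
    proof -
      define q where "q k z = (u (z + X k *\<^sub>R v) - u (z + t *\<^sub>R v)) / (X k - t)" for k z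
      define q' where "q' k z = (if z \<in> Nt then K else q k z)" for k z
      have qi: "q k integrable_on ?B" for k
        unfolding q_def using X t int by (intro integrable_on_divide integrable_diff) auto
      have q'i: "q' k integrable_on ?B" for k
        using qi by (rule integrable_spike[OF _ Nt]) (simp add: q'_def)
      have bd: "norm (q' k z) \<le> L * norm v + \<bar>K\<bar>" if "z \<in> ?B" for k z
      proof -
        have "\<bar>u (z + X k *\<^sub>R v) - u (z + t *\<^sub>R v)\<bar>
            \<le> L * norm ((z + X k *\<^sub>R v) - (z + t *\<^sub>R v))"
          using that X t by (intro lipD tube) auto
        also have "\<dots> = L * norm v * \<bar>X k - t\<bar>"
          by (simp flip: scaleR_diff_left)
        finally have "\<bar>q k z\<bar> \<le> L * norm v"
          using X by (auto simp: q_def divide_simps)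
        moreover have "L * norm v \<ge> 0" using L by simp
        ultimately show ?thesis by (auto simp: q'_def)
      qed
      have conv: "(\<lambda>k. q' k z) \<longlonglongrightarrow> w z" if z: "z \<in> ?B" for z
      proof (cases "z \<in> Nt")
        case False
        let ?p = "\<lambda>s. z + s *\<^sub>R v"
        have "(u has_derivative D (?p t)) (at (?p t))"
          using False z t notN tube by (intro D) auto
        moreover have "(?p has_derivative (\<lambda>h. h *\<^sub>R v)) (at t)"
          by (auto intro!: derivative_eq_intros)
        ultimately have "((\<lambda>s. u (?p s)) has_derivative (\<lambda>h. D (?p t) (h *\<^sub>R v))) (at t)"
          by (rule has_derivative_compose[rotated])
        moreover have "linear (D (?p t))"
          using \<open>(u has_derivative D (?p t)) (at (?p t))\<close> by (rule has_derivative_linear)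
        ultimately have "((\<lambda>s. u (?p s)) has_real_derivative D (?p t) v) (at t)"
          by (simp add: has_field_derivative_def linear_cmul mult_commute_abs)
        then have "((\<lambda>s. (u (?p s) - u (?p t)) / (s - t)) \<longlongrightarrow> D (?p t) v) (at t)"
          by (simp add: has_field_derivative_iff)
        then have "(\<lambda>k. (u (?p (X k)) - u (?p t)) / (X k - t)) \<longlonglongrightarrow> D (?p t) v"
          using X by (auto simp: tendsto_at_iff_sequentially comp_def)
        then show ?thesis
          using False by (simp add: q'_def q_def w_def)
      qed (simp add: q'_def w_def)
      note dom = dominated_convergence[OF q'i integrable_const bd conv]
      have "integral ?B (q' k) = (\<Phi> (X k) - \<Phi> t) / (X k - t)" for k
      proof -
        have "integral ?B (q' k) = integral ?B (q k)"
          by (rule integral_spike[OF Nt]) (simp add: q'_def)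
        also have "\<dots> = (\<Phi> (X k) - \<Phi> t) / (X k - t)"
          unfolding q_def \<Phi>_def using X t int by (simp add: integral_diff)
        finally show ?thesis .
      qed
      then show "((\<lambda>s. (\<Phi> s - \<Phi> t) / (s - t)) \<circ> X) \<longlonglongrightarrow> integral ?B w"
        using dom(2) by (simp add: comp_def)
      show "w integrable_on ?B" by (rule dom(1))
    qed
    have "(\<Phi> has_real_derivative integral ?B w) (at t within {0..1})"
      using lim by (auto simp: has_field_derivative_iff tendsto_at_iff_sequentially)
    moreover have "integral ?B w \<le> measure lborel ?B * K"
    proof -
      \<comment> \<open>Integrability of \<open>w\<close> was obtained along a sequence, so one is
        exhibited; it approaches \<open>t\<close> from whichever side keeps it in the unit
        interval.\<close>
      define Y where "Y k = (if t \<le> 1/2 then t + 1 / (2 * real (Suc k)) else t - 1 / (2 * real (Suc k)))"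
        for k
      have "0 < 1 / (2 * real (Suc k))" "1 / (2 * real (Suc k)) \<le> 1 / 2" for k
        by (auto simp: field_simps)
      then have "\<forall>i. Y i \<in> {0..1} - {t}"
        using t unfolding Y_def by (smt (verit) Diff_iff atLeastAtMost_iff field_sum_of_halves singletonD)
      moreover have "Y \<longlonglongrightarrow> t"
      proof -
        have *: "(\<lambda>k. 1 / (2 * real (Suc k))) \<longlonglongrightarrow> 0"
          using tendsto_mult_left[OF LIMSEQ_inverse_real_of_nat, of "1/2"]
          by (simp add: inverse_eq_divide)
        show ?thesis
          using tendsto_add[OF tendsto_const *, of t] tendsto_diff[OF tendsto_const *, of t]
          unfolding Y_def by (cases "t \<le> 1/2") (simp_all only: if_True if_False add_0_right diff_0_right)
      qed
      ultimately have "w integrable_on ?B" by (rule wint)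
      moreover have "w z \<le> K" if "z \<in> ?B" for z
        using that t tube notN by (auto simp: w_def intro!: DK)
      ultimately have "integral ?B w \<le> integral ?B (\<lambda>_. K)"
        by (intro integral_le) auto
      then show ?thesis by simp
    qed
    ultimately show ?thesis by blast
  qed
  then obtain \<Phi>' where \<Phi>': "\<And>t. t \<in> {0..1} \<Longrightarrow> (\<Phi> has_real_derivative \<Phi>' t) (at t within {0..1})"
    and \<Phi>'K: "\<And>t. t \<in> {0..1} \<Longrightarrow> \<Phi>' t \<le> measure lborel ?B * K"
    by metis
  obtain t where "t \<in> {0..1}" "\<Phi> 1 - \<Phi> 0 = \<Phi>' t * (1 - 0)"
    using mvt_very_simple[of 0 1 \<Phi> "\<lambda>t h. \<Phi>' t * h"] \<Phi>' by (auto simp: has_field_derivative_def)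
  then have upper: "\<Phi> 1 - \<Phi> 0 \<le> measure lborel ?B * K"
    using \<Phi>'K by simp
  \<comment> \<open>For \<open>z\<close> in the box the increment \<open>u (z + v) - u z\<close> is
    within \<open>e\<close> of the one at \<open>x\<close>, so the mean value bound for the averages
    transfers to \<open>x\<close>.\<close>
  have "integral ?B (\<lambda>_. u (x + v) - u x - e) \<le> integral ?B (\<lambda>z. u (z + 1 *\<^sub>R v) - u (z + 0 *\<^sub>R v))"
  proof (intro integral_le integrable_const integrable_diff int)
    fix z assume "z \<in> ?B"
    then have z: "z \<in> S" "z + v \<in> S" "norm (x - z) < \<rho>"
      using cd(1) by (auto simp: A_def dist_norm)
    have "\<bar>u (x + v) - u (z + v)\<bar> \<le> L * norm (x - z)" "\<bar>u z - u x\<bar> \<le> L * norm (x - z)"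
      using lipD[OF x(2) z(2)] lipD[OF z(1) x(1)] by (auto simp: norm_minus_commute)
    moreover have "L * norm (x - z) \<le> L * \<rho>"
      using L z by (intro mult_left_mono) auto
    ultimately show "u (x + v) - u x - e \<le> u (z + 1 *\<^sub>R v) - u (z + 0 *\<^sub>R v)"
      using \<rho> by simp
  qed auto
  also have "\<dots> = \<Phi> 1 - \<Phi> 0"
    unfolding \<Phi>_def by (intro integral_diff int) auto
  finally have "measure lborel ?B * (u (x + v) - u x - e) \<le> measure lborel ?B * K"
    using upper by simp
  then show "u (x + v) - u x \<le> K + e"
    using pos by simp
qed

text \<open>The scalar estimate is applied to the inner product of \<open>g\<close> with
  \<open>w = g y - g x\<close>, along \<open>y - x\<close>; one factor \<open>norm w\<close>
  cancels. The a priori constant \<open>L\<close> drops out of the result.\<close>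

lemma lipschitz_on_of_AE_derivative_le:
  fixes g :: "'a::euclidean_space \<Rightarrow> 'b::real_inner"
  assumes S: "open S" "convex S" and lip: "L-lipschitz_on S g" and N: "negligible N"
    and \<alpha>: "\<alpha> \<ge> 0"
    and der: "\<And>z. z \<in> S - N \<Longrightarrow> \<exists>D. (g has_derivative D) (at z) \<and> (\<forall>v. norm (D v) \<le> \<alpha> * norm v)"
  shows "\<alpha>-lipschitz_on S g"
proof (rule lipschitz_onI)
  fix x y assume xy: "x \<in> S" "y \<in> S"
  define w where "w = g y - g x"
  have "(w \<bullet> g (x + (y - x))) - (w \<bullet> g x) \<le> norm w * (\<alpha> * norm (y - x))"
  proof (rule increment_le_of_AE_derivative_le[OF S _ N])
    show "(norm w * L)-lipschitz_on S (\<lambda>z. w \<bullet> g z)"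
    proof (rule lipschitz_onI)
      fix p q assume "p \<in> S" "q \<in> S"
      have "\<bar>w \<bullet> (g p - g q)\<bar> \<le> norm w * norm (g p - g q)"
        by (rule Cauchy_Schwarz_ineq2)
      also have "\<dots> \<le> norm w * (L * norm (p - q))"
        using lipschitz_onD[OF lip \<open>p \<in> S\<close> \<open>q \<in> S\<close>] by (simp add: dist_norm mult_left_mono)
      finally show "dist (w \<bullet> g p) (w \<bullet> g q) \<le> norm w * L * dist p q"
        by (simp add: dist_norm inner_diff_right)
    qed (use lipschitz_on_nonneg[OF lip] in simp)
    fix z assume "z \<in> S - N"
    then obtain D where D: "(g has_derivative D) (at z)" "\<And>v. norm (D v) \<le> \<alpha> * norm v"
      using der by blast
    have "((\<lambda>z. w \<bullet> g z) has_derivative (\<lambda>v. w \<bullet> D v)) (at z)"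
      using D(1) by (rule has_derivative_inner_right)
    moreover have "w \<bullet> D (y - x) \<le> norm w * (\<alpha> * norm (y - x))"
      using norm_cauchy_schwarz[of w "D (y - x)"] mult_left_mono[OF D(2)[of "y - x"], of "norm w"]
      by simp
    ultimately show "\<exists>D. ((\<lambda>z. w \<bullet> g z) has_derivative D) (at z) \<and>
        D (y - x) \<le> norm w * (\<alpha> * norm (y - x))"
      by blast
  qed (use xy in auto)
  then have "norm w * norm w \<le> norm w * (\<alpha> * norm (y - x))"
    by (simp add: w_def inner_diff_right flip: power2_eq_square dot_square_norm)
  then have "norm w \<le> \<alpha> * norm (y - x)"
    using \<alpha> by (cases "norm w = 0") auto
  then show "dist (g x) (g y) \<le> \<alpha> * dist x y"
    by (simp add: w_def dist_norm norm_minus_commute)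
qed (fact \<alpha>)

section \<open>Accessibility by a chain of curves\<close>

text \<open>The curves are run through one after another over the half-line, which
  \<open>s / (1 - s)\<close> identifies with \<open>[0, 1)\<close>. Continuity at 1 holds because
  the radii \<open>e k\<close> tend to 0.\<close>

lemma accessible_from_chain:
  fixes P :: "nat \<Rightarrow> real \<Rightarrow> 'a::metric_space"
  assumes path: "\<And>k. path (P k)" and join: "\<And>k. pathfinish (P k) = pathstart (P (Suc k))"
    and sub: "\<And>k. path_image (P k) \<subseteq> S"
    and near: "\<And>k. path_image (P k) \<subseteq> cball x (e k)" and e: "e \<longlonglongrightarrow> 0"
  shows "accessible_from S x"
proof -
  define g where "g t = P (nat \<lfloor>t\<rfloor>) (frac t)" for t
  have g_eq: "g t = P n (t - real n)" if "real n \<le> t" "t \<le> real n + 1" for n t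
  proof (cases "t = real n + 1")
    \<comment> \<open>At the right end point the floor already selects the next curve, whose start
      is the end of the present one.\<close>
    case True
    then have "\<lfloor>t\<rfloor> = int (Suc n)" by simp
    then have "g t = P (Suc n) 0"
      using True by (simp add: g_def frac_def nat_add_distrib)
    also have "\<dots> = P n 1"
      using join[of n] by (simp add: pathfinish_def pathstart_def)
    finally show ?thesis using True by simp
  next
    case False
    then have "\<lfloor>t\<rfloor> = int n" using that by (simp add: floor_eq_iff)
    then show ?thesis by (simp add: g_def frac_def)
  qed
  have g_mem: "g t \<in> path_image (P (nat \<lfloor>t\<rfloor>))" for t
    by (simp add: g_def path_image_def frac_lt_1 less_imp_le)
  have contn: "continuous_on {0..real n} g" for n
  proof (induction n)
    case (Suc n)
    have "continuous_on {real n..real n + 1} (\<lambda>t. P n (t - real n))"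
      using path[of n] unfolding path_def
      by (rule continuous_on_compose2) (auto intro!: continuous_intros)
    then have "continuous_on {real n..real n + 1} g"
      by (rule continuous_on_eq) (use g_eq in auto)
    with Suc have "continuous_on ({0..real n} \<union> {real n..real n + 1}) g"
      by (intro continuous_on_closed_Un) auto
    moreover have "{0..real n} \<union> {real n..real n + 1} = {0..real (Suc n)}" by auto
    ultimately show ?case by simp
  qed auto
  have contg: "continuous_on {0..} g"
    unfolding continuous_on_eq_continuous_within
  proof
    fix t :: real assume t: "t \<in> {0..}"
    obtain n where n: "t < real n" using reals_Archimedean2 by blast
    have "continuous (at t within {0..real n}) g"
      using contn[of n] t n by (auto simp: continuous_on_eq_continuous_within)
    moreover have "at t within {0..real n} = at t within {0..}"
      using n by (intro at_within_nhd[where S = "{..<real n}"]) auto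
    ultimately show "continuous (at t within {0..}) g" by simp
  qed
  define \<gamma> where "\<gamma> s = (if s = 1 then x else g (s / (1 - s)))" for s
  have cont01: "continuous_on {0..<1} \<gamma>"
  proof -
    have "continuous_on {0..<1} (\<lambda>s. g (s / (1 - s)))"
      by (rule continuous_on_compose2[OF contg]) (auto intro!: continuous_intros)
    then show ?thesis
      by (rule continuous_on_eq) (auto simp: \<gamma>_def)
  qed
  have "path \<gamma>"
    unfolding path_def continuous_on_eq_continuous_within
  proof
    fix s :: real assume s: "s \<in> {0..1}"
    show "continuous (at s within {0..1}) \<gamma>"
    proof (cases "s = 1")
      case False
      then have "continuous (at s within {0..<1}) \<gamma>"
        using cont01 s by (simp add: continuous_on_eq_continuous_within)
      moreover have "at s within {0..<1} = at s within {0..1}"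
        using False s by (intro at_within_nhd[where S = "{..<1}"]) auto
      ultimately show ?thesis by simp
    next
      case True
      show ?thesis
        unfolding continuous_within_eps_delta
      proof (intro allI impI)
        fix \<epsilon> :: real assume \<epsilon>: "\<epsilon> > 0"
        then obtain K where K: "\<And>k. k \<ge> K \<Longrightarrow> e k < \<epsilon>"
          using order_tendstoD(2)[OF e \<epsilon>] by (auto simp: eventually_sequentially)
        \<comment> \<open>If \<open>1 - s' < 1 / (K + 1)\<close>, then
          \<open>s' / (1 - s') = 1 / (1 - s') - 1\<close> is at least \<open>K\<close>, so only
          curves of index at least \<open>K\<close> are met.\<close>
        have "dist (\<gamma> s') x < \<epsilon>" if "s' \<in> {0..1}" "dist s' 1 < 1 / (real K + 1)" for s'
        proof (cases "s' = 1")
          case s': False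
          have "real K \<le> s' / (1 - s')"
            using that s' by (auto simp: dist_real_def field_simps)
          then have "K \<le> nat \<lfloor>s' / (1 - s')\<rfloor>"
            by (simp add: le_nat_floor)
          moreover have "dist x (g (s' / (1 - s'))) \<le> e (nat \<lfloor>s' / (1 - s')\<rfloor>)"
            using g_mem near by (auto simp: subset_iff)
          ultimately show ?thesis
            using K s' by (force simp: \<gamma>_def dist_commute)
        qed (simp add: \<gamma>_def \<epsilon>)
        then show "\<exists>d>0. \<forall>x'\<in>{0..1}. dist x' s < d \<longrightarrow> dist (\<gamma> x') (\<gamma> s) < \<epsilon>"
          using True by (intro exI[of _ "1 / (real K + 1)"]) (auto simp: \<gamma>_def)
      qed
    qed
  qed
  moreover have "\<gamma> ` {0..<1} \<subseteq> S"
    using g_mem sub by (auto simp: \<gamma>_def)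
  moreover have "pathfinish \<gamma> = x"
    by (simp add: pathfinish_def \<gamma>_def)
  ultimately show ?thesis
    unfolding accessible_from_def by blast
qed

section \<open>Geometry of three-space\<close>

lemma norm_le_abs_3: "norm (x::real^3) \<le> \<bar>x $ 1\<bar> + \<bar>x $ 2\<bar> + \<bar>x $ 3\<bar>"
  using norm_le_l1_cart[of x] by (simp add: sum_3)

lemma norm_eq_sqrt_3: "norm (x::real^3) = sqrt ((x $ 1)\<^sup>2 + (x $ 2)\<^sup>2 + (x $ 3)\<^sup>2)"
  by (simp add: norm_vec_def L2_set_def sum_3)

lemma abs_exp_diff_le:
  fixes s t C :: real
  assumes "s \<le> C" "t \<le> C"
  shows "\<bar>exp s - exp t\<bar> \<le> exp C * \<bar>s - t\<bar>"
proof -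
  have *: "exp t - exp s \<le> exp C * (t - s)" if "s \<le> t" "t \<le> C" for s t
  proof -
    have "1 - exp (s - t) \<le> t - s"
      using exp_ge_add_one_self[of "s - t"] by linarith
    moreover have "exp t - exp s = exp t * (1 - exp (s - t))"
      by (simp add: algebra_simps flip: exp_add)
    ultimately have "exp t - exp s \<le> exp t * (t - s)"
      by (simp add: mult_left_mono)
    also have "\<dots> \<le> exp C * (t - s)"
      using that by (intro mult_right_mono) auto
    finally show ?thesis .
  qed
  show ?thesis
    using *[of s t] *[of t s] assms by (cases "s \<le> t") (auto simp: abs_if)
qed

lemma abs_ln_diff_le:
  fixes \<rho> s t :: real
  assumes "\<rho> > 0" "\<rho> \<le> s" "\<rho> \<le> t"
  shows "\<bar>ln s - ln t\<bar> \<le> \<bar>s - t\<bar> / \<rho>"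
proof -
  have *: "ln t - ln s \<le> (t - s) / \<rho>" if "\<rho> \<le> s" "s \<le> t" for s t
  proof -
    have "ln t - ln s = ln (t / s)" using that assms by (simp add: ln_div)
    also have "\<dots> \<le> t / s - 1" using that assms by (intro ln_le_minus_one) auto
    also have "\<dots> = (t - s) / s" using that assms by (simp add: field_simps)
    also have "\<dots> \<le> (t - s) / \<rho>" using that assms by (intro divide_left_mono) auto
    finally show ?thesis .
  qed
  show ?thesis
    using *[of s t] *[of t s] assms by (cases "s \<le> t") (auto simp: abs_if)
qed

lemma norm_normalize_diff_le:
  fixes x y :: "'a::real_normed_vector"
  assumes "\<rho> > 0" "\<rho> \<le> norm x" "\<rho> \<le> norm y"
  shows "norm (x /\<^sub>R norm x - y /\<^sub>R norm y) \<le> 2 / \<rho> * norm (x - y)"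
proof -
  have nz: "norm x > 0" "norm y > 0" using assms by linarith+
  have "inverse (norm x) - inverse (norm y) = (norm y - norm x) / norm x * inverse (norm y)"
    using nz by (simp add: field_simps)
  moreover have "x /\<^sub>R norm x - y /\<^sub>R norm y
      = (inverse (norm x) - inverse (norm y)) *\<^sub>R y + (x - y) /\<^sub>R norm x"
    by (simp add: algebra_simps)
  ultimately have "x /\<^sub>R norm x - y /\<^sub>R norm y
      = ((norm y - norm x) / norm x) *\<^sub>R (y /\<^sub>R norm y) + (x - y) /\<^sub>R norm x"
    by simp
  then have "norm (x /\<^sub>R norm x - y /\<^sub>R norm y)
      \<le> norm (((norm y - norm x) / norm x) *\<^sub>R (y /\<^sub>R norm y)) + norm ((x - y) /\<^sub>R norm x)"
    by (simp only: norm_triangle_ineq)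
  also have "\<dots> = \<bar>norm y - norm x\<bar> / norm x + norm (x - y) / norm x"
    using nz by (simp add: divide_inverse abs_mult)
  also have "\<dots> = (\<bar>norm y - norm x\<bar> + norm (x - y)) / norm x"
    by (simp add: add_divide_distrib)
  also have "\<dots> \<le> (2 * norm (x - y)) / norm x"
    using nz norm_triangle_ineq3[of y x] by (intro divide_right_mono) (auto simp: norm_minus_commute)
  also have "\<dots> \<le> (2 * norm (x - y)) / \<rho>"
    using assms nz by (intro divide_left_mono) auto
  finally show ?thesis by simp
qed

lemma component_3_add_vector [simp]:
  "(y + vector [0, 0, a] :: real^3) $ 1 = y $ 1" "(y + vector [0, 0, a] :: real^3) $ 2 = y $ 2"
  "(y + vector [0, 0, a] :: real^3) $ 3 = y $ 3 + a"
  by simp_all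

lemma open_upper_halfspace: "open {y :: real^3. c < y $ 3}"
  by (rule open_halfspace_component_gt_cart)

lemma convex_upper_halfspace: "convex {y :: real^3. c < y $ 3}"
  using convex_halfspace_gt[of c "axis 3 1 :: real^3"] by (simp add: inner_axis inner_commute)

lemma open_lower_halfspace: "open {y :: real^3. y $ 3 < c}"
  by (rule open_halfspace_component_lt_cart)

lemma convex_lower_halfspace: "convex {y :: real^3. y $ 3 < c}"
  using convex_halfspace_lt[of "axis 3 1 :: real^3" c] by (simp add: inner_axis inner_commute)

lemma continuous_on_vector_3:
  fixes f g h :: "'a::topological_space \<Rightarrow> real"
  assumes "continuous_on S f" "continuous_on S g" "continuous_on S h"
  shows "continuous_on S (\<lambda>x. vector [f x, g x, h x] :: real^3)"
proof -
  have "vector [f x, g x, h x] = f x *\<^sub>R axis 1 1 + g x *\<^sub>R axis 2 1 + h x *\<^sub>R (axis 3 1 :: real^3)" for x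
    by (simp add: vec_eq_iff forall_3 axis_def)
  then show ?thesis
    using assms by (simp only:) (intro continuous_intros)
qed

lemma less_ln_of_exp_less: "exp u < v \<Longrightarrow> u < ln v" for u v :: real
  by (metis exp_gt_zero exp_less_cancel_iff exp_ln less_trans)

text \<open>The set \<open>E\<close> is a circular arc of constant norm and constant first coordinate, starting at \<open>Y\<close>
  and ending in an annulus of the plane \<open>x\<^sub>3 = 0\<close>.\<close>

lemma path_connected_arc_annulus:
  fixes Y :: "real^3"
  assumes Y: "Y $ 3 > 0" and lohi: "lo \<le> ln (norm Y)" "ln (norm Y) \<le> hi"
  obtains E where "path_connected E" "Y \<in> E"
    "\<And>Z. Z \<noteq> 0 \<Longrightarrow> Z $ 3 = 0 \<Longrightarrow> ln (norm Z) \<in> {lo..hi} \<Longrightarrow> Z \<in> E"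
    "\<And>Z. Z \<in> E \<Longrightarrow> Z \<noteq> 0 \<and> Z $ 3 \<ge> 0 \<and> (Z $ 1 = Y $ 1 \<or> Z $ 3 = 0) \<and> ln (norm Z) \<in> {lo..hi}"
proof -
  define r where "r = sqrt ((Y $ 2)\<^sup>2 + (Y $ 3)\<^sup>2)"
  have r2: "r\<^sup>2 = (Y $ 2)\<^sup>2 + (Y $ 3)\<^sup>2"
    by (simp add: r_def)
  have r: "r > 0"
    using Y by (simp add: r_def add_nonneg_pos)
  \<comment> \<open>\<open>w\<close> turns \<open>Y\<close> about the first axis and traces the arc
    \<open>A\<close>; \<open>v\<close> gives polar coordinates, with logarithmic radius, on the
    annulus \<open>B\<close>.\<close>
  define w where "w \<theta> = (vector [Y $ 1, r * cos \<theta>, r * sin \<theta>] :: real^3)" for \<theta>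
  define v where "v t \<theta> = (vector [exp t * cos \<theta>, exp t * sin \<theta>, 0] :: real^3)" for t \<theta>
  have nw: "norm (w \<theta>) = norm Y" for \<theta>
  proof -
    have "(r * cos \<theta>)\<^sup>2 + (r * sin \<theta>)\<^sup>2 = r\<^sup>2"
      by (simp add: power_mult_distrib flip: distrib_left)
    then show ?thesis
      unfolding norm_eq_sqrt_3 by (simp add: w_def r2 add.assoc)
  qed
  have nv: "norm (v t \<theta>) = exp t" for t \<theta>
  proof -
    have "(exp t * cos \<theta>)\<^sup>2 + (exp t * sin \<theta>)\<^sup>2 = (exp t)\<^sup>2"
      by (simp add: power_mult_distrib flip: distrib_left)
    then show ?thesis
      unfolding norm_eq_sqrt_3 by (simp add: v_def)
  qed
  define A where "A = w ` {0..pi}"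
  define B where "B = (\<lambda>x. v (fst x) (snd x)) ` ({lo..hi} \<times> {0..2 * pi})"
  have BI: "Z \<in> B" if Z: "Z \<noteq> 0" "Z $ 3 = 0" "ln (norm Z) \<in> {lo..hi}" for Z
  proof -
    have "(norm Z)\<^sup>2 = (Z $ 1)\<^sup>2 + (Z $ 2)\<^sup>2"
      using Z(2) by (simp add: norm_eq_sqrt_3)
    moreover have "(Z $ 1 / norm Z)\<^sup>2 + (Z $ 2 / norm Z)\<^sup>2 = ((Z $ 1)\<^sup>2 + (Z $ 2)\<^sup>2) / (norm Z)\<^sup>2"
      by (simp add: power_divide add_divide_distrib)
    ultimately have "(Z $ 1 / norm Z)\<^sup>2 + (Z $ 2 / norm Z)\<^sup>2 = 1"
      using Z(1) by (metis divide_self norm_eq_zero power_not_zero)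
    then obtain \<theta> where \<theta>: "0 \<le> \<theta>" "\<theta> \<le> 2 * pi" "Z $ 1 / norm Z = cos \<theta>" "Z $ 2 / norm Z = sin \<theta>"
      using sincos_total_2pi_le by blast
    have "v (ln (norm Z)) \<theta> = Z"
      using Z(1,2) by (simp add: v_def vec_eq_iff forall_3 flip: \<theta>(3,4))
    then show ?thesis
      unfolding B_def using \<theta>(1,2) Z(3) by (intro image_eqI[of _ _ "(ln (norm Z), \<theta>)"]) auto
  qed
  have "path_connected A"
    unfolding A_def w_def
    by (intro path_connected_continuous_image convex_imp_path_connected continuous_on_vector_3
        continuous_intros convex_real_interval)
  moreover have "path_connected B"
    unfolding B_def v_def
    by (intro path_connected_continuous_image convex_imp_path_connected continuous_on_vector_3
        continuous_intros convex_Times convex_real_interval)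
  \<comment> \<open>At angle 0 the arc reaches the plane \<open>x\<^sub>3 = 0\<close> with its norm
    unchanged, hence inside the annulus; this point links the two pieces.\<close>
  moreover have "w 0 \<in> A \<inter> B"
  proof
    show "w 0 \<in> A" unfolding A_def by (rule imageI) simp
    show "w 0 \<in> B"
    proof (rule BI)
      have "norm Y \<noteq> 0" using Y by auto
      then show "w 0 \<noteq> 0" using nw[of 0] by auto
      show "ln (norm (w 0)) \<in> {lo..hi}" using lohi by (simp add: nw)
    qed (simp add: w_def)
  qed
  ultimately have "path_connected (A \<union> B)"
    by (intro path_connected_Un) auto
  moreover have "Y \<in> A \<union> B"
  proof -
    have "(Y $ 2 / r)\<^sup>2 + (Y $ 3 / r)\<^sup>2 = 1"
      using r by (simp add: power_divide r2[symmetric] flip: add_divide_distrib)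
    then obtain \<theta> where \<theta>: "0 \<le> \<theta>" "\<theta> \<le> pi" "Y $ 2 / r = cos \<theta>" "Y $ 3 / r = sin \<theta>"
      using sincos_total_pi[of "Y $ 3 / r" "Y $ 2 / r"] Y r by auto
    have "w \<theta> = Y"
      using r by (simp add: w_def vec_eq_iff forall_3 flip: \<theta>(3,4))
    then have "Y \<in> A"
      unfolding A_def using \<theta>(1,2) by (intro image_eqI[of _ _ \<theta>]) auto
    then show ?thesis by simp
  qed
  moreover have "Z \<noteq> 0 \<and> Z $ 3 \<ge> 0 \<and> (Z $ 1 = Y $ 1 \<or> Z $ 3 = 0) \<and> ln (norm Z) \<in> {lo..hi}"
    if "Z \<in> A \<union> B" for Z
    using that
  proof
    assume "Z \<in> A"
    then obtain \<theta> where \<theta>: "\<theta> \<in> {0..pi}" "Z = w \<theta>" by (auto simp: A_def)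
    have "norm Z \<noteq> 0" using Y \<theta>(2) nw[of \<theta>] by auto
    moreover have "Z $ 3 \<ge> 0" using \<theta> r by (simp add: w_def sin_ge_zero)
    moreover have "Z $ 1 = Y $ 1" using \<theta> by (simp add: w_def)
    moreover have "ln (norm Z) \<in> {lo..hi}" using \<theta>(2) lohi by (simp add: nw)
    ultimately show ?thesis by auto
  next
    assume "Z \<in> B"
    then obtain t \<theta> where t: "t \<in> {lo..hi}" "Z = v t \<theta>" by (auto simp: B_def)
    have "Z \<noteq> 0" using t(2) nv[of t \<theta>] by auto
    moreover have "Z $ 3 = 0" using t by (simp add: v_def)
    moreover have "ln (norm Z) \<in> {lo..hi}" using t nv by simp
    ultimately show ?thesis by simp
  qed
  ultimately show thesis using that[of "A \<union> B"] BI by blast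
qed

lemma min_stretch_le:
  assumes "linear T"
  shows "min_stretch T * norm v \<le> norm (T v)"
proof (cases "v = 0")
  case False
  have "min_stretch T \<le> norm (T (v /\<^sub>R norm v))"
    unfolding min_stretch_def using False by (intro cINF_lower bdd_belowI2[of _ 0]) auto
  also have "\<dots> = norm (T v) / norm v"
    using assms by (simp add: linear_cmul divide_inverse mult.commute)
  finally show ?thesis using False by (simp add: field_simps)
qed simp

section \<open>Zorich maps and their inverse branches\<close>

lemma fold_wave_ge: "1 - \<bar>u - 1 - 4 * of_int k\<bar> \<le> fold_wave u"
proof (cases "\<bar>u - 1 - 4 * of_int k\<bar> < 2")
  case True
  then have "\<lfloor>(u + 1) / 4\<rfloor> = k" by (auto simp: floor_eq_iff field_simps)
  then show ?thesis by (auto simp: fold_wave_def Let_def)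
next
  case False
  then show ?thesis using abs_fold_wave_le[of u] by linarith
qed

lemma fold_wave_attained: "\<exists>k. fold_wave u = 1 - \<bar>u - 1 - 4 * of_int k\<bar>"
  by (rule exI[of _ "\<lfloor>(u + 1) / 4\<rfloor>"]) (auto simp: fold_wave_def Let_def)

text \<open>By the two preceding facts the wave is the maximum over all integers \<open>k\<close> of
  the tents \<open>1 - \<bar>u - 1 - 4 * k\<bar>\<close>, each of which is 1-Lipschitz.\<close>

lemma fold_wave_lipschitz: "\<bar>fold_wave u - fold_wave v\<bar> \<le> \<bar>u - v\<bar>"
proof -
  have "fold_wave v - fold_wave u \<le> \<bar>u - v\<bar>" for u v
  proof -
    obtain k where "fold_wave v = 1 - \<bar>v - 1 - 4 * of_int k\<bar>"
      using fold_wave_attained by blast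
    then show ?thesis using fold_wave_ge[of u k] by linarith
  qed
  from this[of u v] this[of v u] show ?thesis by linarith
qed

lemma abs_minus_beam_index: "\<bar>u - 2 * of_int (beam_index u)\<bar> \<le> 1"
  unfolding beam_index_def using floor_correct[of "(u + 1) / 2"] by (simp add: abs_le_iff field_simps)

lemma abs_fold_wave_odd: "\<bar>fold_wave (2 * of_int k + 1)\<bar> = 1"
  using fold_wave_eq[of "2 * of_int k + 1" k] by (simp add: power_int_minus_left)

lemma beam_index_neq_imp_odd_between:
  assumes "beam_index u \<noteq> beam_index v"
  obtains t k where "0 \<le> t" "t \<le> 1" "(1 - t) * u + t * v = 2 * of_int k + 1"
proof -
  have main: "\<exists>t k. 0 \<le> t \<and> t \<le> 1 \<and> (1 - t) * u + t * v = 2 * of_int k + 1"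
    if lt: "beam_index u < beam_index v" for u v
  proof -
    \<comment> \<open>This is the upper end of the beam of \<open>u\<close>. As
      \<open>beam_index\<close> takes the larger index at odd points, \<open>u < w\<close> is strict
      and the division in \<open>t\<close> is safe.\<close>
    define w where "w = 2 * of_int (beam_index u) + (1::real)"
    have "real_of_int \<lfloor>(u + 1) / 2\<rfloor> + 1 \<le> real_of_int \<lfloor>(v + 1) / 2\<rfloor>"
      using lt unfolding beam_index_def by linarith
    then have "u < w" "w \<le> v"
      using floor_correct[of "(u + 1) / 2"] floor_correct[of "(v + 1) / 2"]
      unfolding w_def beam_index_def of_int_add of_int_1 by argo+
    define t where "t = (w - u) / (v - u)"
    have "0 \<le> t" "t \<le> 1" "t * (v - u) = w - u"
      using \<open>u < w\<close> \<open>w \<le> v\<close> by (auto simp: t_def field_simps)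
    then show ?thesis
      by (intro exI[of _ t] exI[of _ "beam_index u"]) (auto simp: w_def algebra_simps)
  qed
  show thesis
  proof (cases "beam_index u < beam_index v")
    case True
    then show thesis using main that by blast
  next
    case False
    then have "beam_index v < beam_index u" using assms by linarith
    then obtain t k where "0 \<le> t" "t \<le> 1" "(1 - t) * v + t * u = 2 * of_int k + 1"
      using main by blast
    then show thesis by (intro that[of "1 - t" k]) (auto simp: algebra_simps)
  qed
qed

section \<open>Folding the beams onto the square\<close>

definition fold_point :: "real^3 \<Rightarrow> real^2" where
  "fold_point x = vector [fold_wave (x $ 1), fold_wave (x $ 2)]"

lemma fold_point_nth [simp]:
  "fold_point x $ 1 = fold_wave (x $ 1)" "fold_point x $ 2 = fold_wave (x $ 2)"
  by (simp_all add: fold_point_def)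

lemma fold_point_in_square: "fold_point x \<in> square"
  by (simp add: square_def abs_fold_wave_le)

lemma dist_fold_point_le: "dist (fold_point x) (fold_point y) \<le> 2 * dist x y"
proof -
  have "norm (fold_point x - fold_point y)
      \<le> \<bar>fold_wave (x $ 1) - fold_wave (y $ 1)\<bar> + \<bar>fold_wave (x $ 2) - fold_wave (y $ 2)\<bar>"
    using norm_le_l1_cart[of "fold_point x - fold_point y"] by (simp add: sum_2)
  also have "\<dots> \<le> norm (x - y) + norm (x - y)"
    using fold_wave_lipschitz[of "x $ 1" "y $ 1"] fold_wave_lipschitz[of "x $ 2" "y $ 2"]
      component_le_norm_cart[of "x - y" 1] component_le_norm_cart[of "x - y" 2]
    by simp
  finally show ?thesis by (simp add: dist_norm)
qed

definition beam :: "int \<Rightarrow> int \<Rightarrow> (real^3) set" where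
  "beam r1 r2 = {x. \<bar>x $ 1 - 2 * of_int r1\<bar> \<le> 1 \<and> \<bar>x $ 2 - 2 * of_int r2\<bar> \<le> 1}"

lemma beam_width:
  assumes "x \<in> beam r1 r2" "y \<in> beam r1 r2"
  shows "\<bar>x $ 1 - y $ 1\<bar> \<le> 2" "\<bar>x $ 2 - y $ 2\<bar> \<le> 2"
  using assms unfolding beam_def mem_Collect_eq by linarith+

section \<open>Norm, sign and Lipschitz continuity of the Zorich map\<close>

locale zorich =
  fixes h :: "real^2 \<Rightarrow> real^3"
  assumes bilip: "bilipschitz_on square h" and onto: "h ` square = upper_hemisphere"
begin

abbreviation "F \<equiv> zorich_F h"

definition sheet_sign :: "real^3 \<Rightarrow> real" where
  "sheet_sign x = (-1) powi (beam_index (x $ 1) + beam_index (x $ 2))"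

lemma abs_sheet_sign [simp]: "\<bar>sheet_sign x\<bar> = 1"
  by (simp add: sheet_sign_def power_int_minus_left)

lemma sheet_sign_neq_0 [simp]: "sheet_sign x \<noteq> 0"
  by (simp add: sheet_sign_def)

lemma h_fold_point: "h (fold_point x) \<in> upper_hemisphere"
  using onto fold_point_in_square by blast

lemma norm_h_fold_point [simp]: "norm (h (fold_point x)) = 1"
  using h_fold_point[of x] by (simp add: norm_eq_sqrt_3 upper_hemisphere_def)

lemma F_nth:
  "F x $ 1 = exp (x $ 3) * h (fold_point x) $ 1"
  "F x $ 2 = exp (x $ 3) * h (fold_point x) $ 2"
  "F x $ 3 = exp (x $ 3) * (sheet_sign x * h (fold_point x) $ 3)"
  by (simp_all add: zorich_F_def sheet_sign_def fold_point_def Let_def)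

lemma norm_F: "norm (F x) = exp (x $ 3)"
proof -
  have "(sheet_sign x)\<^sup>2 = 1"
    using abs_sheet_sign[of x] by (metis power2_abs power_one)
  then have "(F x $ 1)\<^sup>2 + (F x $ 2)\<^sup>2 + (F x $ 3)\<^sup>2
      = (exp (x $ 3))\<^sup>2 * ((h (fold_point x) $ 1)\<^sup>2 + (h (fold_point x) $ 2)\<^sup>2 + (h (fold_point x) $ 3)\<^sup>2)"
    by (simp add: F_nth power_mult_distrib algebra_simps)
  then show ?thesis
    using h_fold_point[of x] by (simp add: norm_eq_sqrt_3 upper_hemisphere_def)
qed

lemma F_3_eq_0:
  assumes "x $ 1 = 2 * of_int k + 1 \<or> x $ 2 = 2 * of_int k + 1"
  shows "F x $ 3 = 0"
proof -
  have "h (fold_point x) $ 3 = 0"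
    using assms abs_fold_wave_odd[of k]
    by (intro equator_of_side[OF bilip onto fold_point_in_square]) auto
  then show ?thesis by (simp add: F_nth)
qed

lemma F_eq_on_beam:
  assumes "x \<in> beam r1 r2" "even (r1 + r2)"
  shows "F x = exp (x $ 3) *\<^sub>R h (fold_point x)"
proof -
  have "F x = exp (x $ 3) *\<^sub>R vector [h (fold_point x) $ 1, h (fold_point x) $ 2,
      (-1) powi (r1 + r2) * h (fold_point x) $ 3]"
    using zorich_F_eq[OF bilip onto] assms(1) by (simp add: beam_def fold_point_def)
  then show ?thesis
    using assms(2) by (simp add: power_int_minus_left vec_eq_iff forall_3)
qed

text \<open>Division by the norm \<open>exp (x $ 3)\<close> leaves a map \<open>G\<close> into the
  sphere. It is Lipschitz because the sign jumps only across walls, where the component that it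
  multiplies vanishes. Below height \<open>C\<close> the exponential factor is bounded and
  Lipschitz. The constant serves as the a priori bound in \<open>F_contracting\<close> and shows
  that \<open>F\<close> preserves null sets.\<close>

lemma F_lipschitz: "\<exists>K. K-lipschitz_on {x. x $ 3 \<le> C} F"
proof -
  obtain L where L: "L \<ge> 1"
    and up: "\<And>x y. x \<in> square \<Longrightarrow> y \<in> square \<Longrightarrow> dist (h x) (h y) \<le> L * dist x y"
    using bilip by (auto simp: bilipschitz_on_def)
  define k where "k x = h (fold_point x)" for x
  have k: "norm (k x - k y) \<le> 2 * L * norm (x - y)" for x y
  proof -
    have "dist (k x) (k y) \<le> L * dist (fold_point x) (fold_point y)"
      unfolding k_def by (intro up fold_point_in_square)
    also have "\<dots> \<le> L * (2 * dist x y)"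
      using L by (intro mult_left_mono dist_fold_point_le) auto
    finally show ?thesis by (simp add: dist_norm)
  qed
  have ki: "\<bar>k x $ i - k y $ i\<bar> \<le> 2 * L * norm (x - y)" for x y i
    using component_le_norm_cart[of "k x - k y" i] k[of x y] by simp
  have k3: "\<bar>sheet_sign x * k x $ 3 - sheet_sign y * k y $ 3\<bar> \<le> 2 * L * norm (x - y)" for x y
  proof (cases "beam_index (x $ 1) = beam_index (y $ 1) \<and> beam_index (x $ 2) = beam_index (y $ 2)")
    case True
    then have "sheet_sign x * k x $ 3 - sheet_sign y * k y $ 3 = sheet_sign x * (k x $ 3 - k y $ 3)"
      by (simp add: sheet_sign_def algebra_simps)
    then show ?thesis
      using ki[of x 3 y] by (simp add: abs_mult)
  next
    case False
    \<comment> \<open>The segment from \<open>x\<close> to \<open>y\<close> then meets a wall, where the third component vanishes.\<close>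
    have "\<exists>t l. 0 \<le> t \<and> t \<le> 1 \<and> ((1 - t) * x $ 1 + t * y $ 1 = 2 * of_int l + 1 \<or>
        (1 - t) * x $ 2 + t * y $ 2 = 2 * of_int l + 1)"
      using False by (metis beam_index_neq_imp_odd_between)
    then obtain t l where t: "0 \<le> t" "t \<le> 1"
      and "(1 - t) * x $ 1 + t * y $ 1 = 2 * of_int l + 1 \<or>
        (1 - t) * x $ 2 + t * y $ 2 = 2 * of_int l + 1"
      by blast
    moreover define w where "w = (1 - t) *\<^sub>R x + t *\<^sub>R y"
    ultimately have "F w $ 3 = 0"
      by (intro F_3_eq_0[of _ l]) auto
    then have "k w $ 3 = 0"
      by (simp add: F_nth k_def)
    then have "\<bar>k x $ 3\<bar> \<le> 2 * L * norm (x - w)" "\<bar>k y $ 3\<bar> \<le> 2 * L * norm (w - y)"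
      using ki[of x 3 w] ki[of w 3 y] by auto
    moreover have "x - w = t *\<^sub>R (x - y)" "w - y = (1 - t) *\<^sub>R (x - y)"
      by (simp_all add: w_def algebra_simps)
    then have "norm (x - w) = t * norm (x - y)" "norm (w - y) = (1 - t) * norm (x - y)"
      using t by simp_all
    then have "norm (x - w) + norm (w - y) = norm (x - y)"
      by (simp add: algebra_simps)
    then have "2 * L * norm (x - w) + 2 * L * norm (w - y) = 2 * L * norm (x - y)"
      by (simp flip: distrib_left)
    moreover have "\<bar>sheet_sign x * k x $ 3\<bar> = \<bar>k x $ 3\<bar>" "\<bar>sheet_sign y * k y $ 3\<bar> = \<bar>k y $ 3\<bar>"
      by (simp_all add: abs_mult)
    ultimately show ?thesis by linarith
  qed
  define G where "G x = exp (- x $ 3) *\<^sub>R F x" for x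
  have nG: "norm (G x) = 1" for x
    by (simp add: G_def norm_F flip: exp_add)
  have G_nth: "G x $ 1 = k x $ 1" "G x $ 2 = k x $ 2" "G x $ 3 = sheet_sign x * k x $ 3" for x
    by (simp_all add: G_def F_nth k_def exp_minus)
  have G: "norm (G x - G y) \<le> 6 * L * norm (x - y)" for x y
    using norm_le_abs_3[of "G x - G y"] ki[of x 1 y] ki[of x 2 y] k3[of x y]
    unfolding vector_minus_component G_nth by linarith
  \<comment> \<open>Each of the three components of \<open>G\<close> contributes
    \<open>2 * L\<close>; the 1 comes from varying the exponential factor.\<close>
  have "(exp C * (1 + 6 * L))-lipschitz_on {x. x $ 3 \<le> C} F"
  proof (rule lipschitz_onI)
    fix x y :: "real^3" assume xy: "x \<in> {x. x $ 3 \<le> C}" "y \<in> {x. x $ 3 \<le> C}"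
    have "F x - F y = (exp (x $ 3) - exp (y $ 3)) *\<^sub>R G x + exp (y $ 3) *\<^sub>R (G x - G y)"
      by (simp add: G_def exp_minus algebra_simps)
    then have "norm (F x - F y) \<le> \<bar>exp (x $ 3) - exp (y $ 3)\<bar> * norm (G x) + exp (y $ 3) * norm (G x - G y)"
      using norm_triangle_ineq[of "(exp (x $ 3) - exp (y $ 3)) *\<^sub>R G x" "exp (y $ 3) *\<^sub>R (G x - G y)"]
      by simp
    also have "\<dots> \<le> exp C * norm (x - y) * 1 + exp C * (6 * L * norm (x - y))"
    proof (intro add_mono mult_mono)
      have "\<bar>exp (x $ 3) - exp (y $ 3)\<bar> \<le> exp C * \<bar>x $ 3 - y $ 3\<bar>"
        using xy by (intro abs_exp_diff_le) auto
      also have "\<dots> \<le> exp C * norm (x - y)"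
        using component_le_norm_cart[of "x - y" 3] by simp
      finally show "\<bar>exp (x $ 3) - exp (y $ 3)\<bar> \<le> exp C * norm (x - y)" .
    qed (use xy nG G in auto)
    finally show "dist (F x) (F y) \<le> exp C * (1 + 6 * L) * dist x y"
      by (simp add: dist_norm algebra_simps)
  qed (use L in auto)
  then show ?thesis by blast
qed

section \<open>Inverse branches of the Zorich map on single beams\<close>

definition branch :: "int \<Rightarrow> int \<Rightarrow> real^3 \<Rightarrow> real^3" where
  "branch r1 r2 Y = (let q = inv_into square h (Y /\<^sub>R norm Y) in
     vector [2 * of_int r1 + (-1) powi r1 * q $ 1, 2 * of_int r2 + (-1) powi r2 * q $ 2, ln (norm Y)])"

lemma normalize_in_hemisphere:
  assumes "Y $ 3 \<ge> 0" "Y \<noteq> 0"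
  shows "Y /\<^sub>R norm Y \<in> upper_hemisphere"
proof -
  have "norm (Y /\<^sub>R norm Y) = 1" using assms by simp
  then show ?thesis
    using assms unfolding norm_eq_sqrt_3 upper_hemisphere_def by (auto simp: divide_inverse)
qed

lemma branch_3 [simp]: "branch r1 r2 Y $ 3 = ln (norm Y)"
  by (simp add: branch_def Let_def)

lemma fold_wave_beam: "\<bar>q\<bar> \<le> 1 \<Longrightarrow> fold_wave (2 * of_int r + (-1) powi r * q) = q"
  by (subst fold_wave_eq[of _ r]) (auto simp: power_int_minus_left abs_le_iff)

text \<open>The direction of \<open>Y\<close> determines the point \<open>q\<close> of the square,
  and its norm the height, as \<open>norm_F\<close> shows. The factors \<open>(-1) powi r1\<close>
  and \<open>(-1) powi r2\<close> undo the reflections in \<open>fold_wave\<close>. Parity matters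
  because odd beams go to the lower half-space.\<close>

lemma
  assumes Y: "Y $ 3 \<ge> 0" "Y \<noteq> 0"
  shows branch_in_beam: "branch r1 r2 Y \<in> beam r1 r2"
    and F_branch: "even (r1 + r2) \<Longrightarrow> F (branch r1 r2 Y) = Y"
proof -
  define q where "q = inv_into square h (Y /\<^sub>R norm Y)"
  have im: "Y /\<^sub>R norm Y \<in> h ` square"
    using normalize_in_hemisphere[OF Y] onto by simp
  then have q: "q \<in> square" "h q = Y /\<^sub>R norm Y"
    by (simp_all add: q_def inv_into_into f_inv_into_f)
  then have qi: "\<bar>q $ 1\<bar> \<le> 1" "\<bar>q $ 2\<bar> \<le> 1" by (simp_all add: square_def)
  have b: "branch r1 r2 Y $ 1 = 2 * of_int r1 + (-1) powi r1 * q $ 1"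
    "branch r1 r2 Y $ 2 = 2 * of_int r2 + (-1) powi r2 * q $ 2"
    by (simp_all add: branch_def Let_def q_def)
  show beam: "branch r1 r2 Y \<in> beam r1 r2"
    using qi by (simp add: beam_def b abs_mult power_int_minus_left)
  show "F (branch r1 r2 Y) = Y" if "even (r1 + r2)"
  proof -
    have "fold_point (branch r1 r2 Y) = q"
      using qi by (simp add: vec_eq_iff forall_2 b fold_wave_beam)
    then show ?thesis
      using F_eq_on_beam[OF beam that] q Y by simp
  qed
qed

lemma branch_F:
  assumes "x \<in> beam r1 r2" "even (r1 + r2)"
  shows "branch r1 r2 (F x) = x"
proof -
  have "inj_on h square"
    using bilipschitz_on_homeomorphism[OF bilip] by (metis homeomorphism_def inj_on_inverseI)
  then have "inv_into square h (F x /\<^sub>R norm (F x)) = fold_point x"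
    using F_eq_on_beam[OF assms] by (simp add: norm_F inv_into_f_f fold_point_in_square)
  moreover have "2 * of_int r + (-1) powi r * fold_wave u = u" if "\<bar>u - 2 * of_int r\<bar> \<le> 1" for u r
    using fold_wave_eq[OF that] by (simp add: power_int_minus_left)
  ultimately show ?thesis
    using assms(1) by (simp add: branch_def Let_def vec_eq_iff forall_3 norm_F beam_def)
qed

text \<open>Away from the origin both the normalization and the logarithm of the norm are Lipschitz,
  and the lower bilipschitz bound controls the inverse of \<open>h\<close>. Each horizontal
  coordinate contributes \<open>2 * L / \<rho>\<close> to the constant, the height
  \<open>1 / \<rho>\<close>.\<close>

lemma branch_lipschitz:
  assumes \<rho>: "\<rho> > 0"
  shows "\<exists>K. K-lipschitz_on {Y. Y $ 3 \<ge> 0 \<and> norm Y \<ge> \<rho>} (branch r1 r2)"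
proof -
  obtain L where L: "L \<ge> 1"
    and lo: "\<And>x y. x \<in> square \<Longrightarrow> y \<in> square \<Longrightarrow> dist x y / L \<le> dist (h x) (h y)"
    using bilip by (auto simp: bilipschitz_on_def)
  define g where "g Y = inv_into square h (Y /\<^sub>R norm Y)" for Y :: "real^3"
  have "((4 * L + 1) / \<rho>)-lipschitz_on {Y. Y $ 3 \<ge> 0 \<and> norm Y \<ge> \<rho>} (branch r1 r2)"
  proof (rule lipschitz_onI)
    fix Y Z :: "real^3"
    assume "Y \<in> {Y. Y $ 3 \<ge> 0 \<and> norm Y \<ge> \<rho>}" "Z \<in> {Y. Y $ 3 \<ge> 0 \<and> norm Y \<ge> \<rho>}"
    then have Y: "Y $ 3 \<ge> 0" "norm Y \<ge> \<rho>" and Z: "Z $ 3 \<ge> 0" "norm Z \<ge> \<rho>"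
      by auto
    then have "Y /\<^sub>R norm Y \<in> h ` square" "Z /\<^sub>R norm Z \<in> h ` square"
      unfolding onto using \<rho> Y Z by (intro normalize_in_hemisphere; force)+
    then have g: "g Y \<in> square" "h (g Y) = Y /\<^sub>R norm Y" "g Z \<in> square" "h (g Z) = Z /\<^sub>R norm Z"
      by (simp_all add: g_def inv_into_into f_inv_into_f)
    have "norm (g Y - g Z) \<le> L * norm (Y /\<^sub>R norm Y - Z /\<^sub>R norm Z)"
      using lo[OF g(1,3)] g L by (simp add: dist_norm field_simps)
    also have "\<dots> \<le> L * (2 / \<rho> * norm (Y - Z))"
      using L \<rho> Y Z by (intro mult_left_mono norm_normalize_diff_le) auto
    finally have gd: "norm (g Y - g Z) \<le> 2 * L / \<rho> * norm (Y - Z)"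
      by (simp add: mult.assoc mult.left_commute)
    have "\<bar>branch r1 r2 Y $ 1 - branch r1 r2 Z $ 1\<bar> = \<bar>(g Y - g Z) $ 1\<bar>"
      "\<bar>branch r1 r2 Y $ 2 - branch r1 r2 Z $ 2\<bar> = \<bar>(g Y - g Z) $ 2\<bar>"
      by (auto simp: branch_def Let_def g_def power_int_minus_left)
    then have "\<bar>branch r1 r2 Y $ 1 - branch r1 r2 Z $ 1\<bar> \<le> 2 * L / \<rho> * norm (Y - Z)"
      "\<bar>branch r1 r2 Y $ 2 - branch r1 r2 Z $ 2\<bar> \<le> 2 * L / \<rho> * norm (Y - Z)"
      using gd component_le_norm_cart[of "g Y - g Z" 1] component_le_norm_cart[of "g Y - g Z" 2]
      by linarith+
    moreover have "\<bar>ln (norm Y) - ln (norm Z)\<bar> \<le> norm (Y - Z) / \<rho>"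
      using abs_ln_diff_le[OF \<rho> Y(2) Z(2)] norm_triangle_ineq3[of Y Z] \<rho>
      by (smt (verit) divide_right_mono)
    moreover have "2 * L / \<rho> * norm (Y - Z) + 2 * L / \<rho> * norm (Y - Z) + norm (Y - Z) / \<rho>
        = (4 * L + 1) / \<rho> * norm (Y - Z)"
      using \<rho> by (simp add: field_simps)
    ultimately show "dist (branch r1 r2 Y) (branch r1 r2 Z) \<le> (4 * L + 1) / \<rho> * dist Y Z"
      using norm_le_abs_3[of "branch r1 r2 Y - branch r1 r2 Z"]
      unfolding dist_norm vector_minus_component branch_3 by linarith
  qed (use L \<rho> in auto)
  then show ?thesis by blast
qed

section \<open>From the derivative bounds to Lipschitz constants of \<open>F\<close> and its
  branches\<close>

lemma F_3_le: "x $ 3 \<le> c \<Longrightarrow> F x $ 3 \<le> exp c"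
  using component_le_norm_cart[of "F x" 3] norm_F[of x] exp_le_cancel_iff[of "x $ 3" c] by linarith

lemma F_contracting:
  assumes ae: "AE x in lebesgue. x $ 3 \<le> m \<longrightarrow>
      F differentiable (at x) \<and> onorm (frechet_derivative F (at x)) \<le> \<alpha>"
    and "\<alpha> > 0"
  shows "\<alpha>-lipschitz_on {x. x $ 3 < m} F"
proof -
  obtain N where N: "negligible N" "{x. \<not> (x $ 3 \<le> m \<longrightarrow>
      F differentiable (at x) \<and> onorm (frechet_derivative F (at x)) \<le> \<alpha>)} \<subseteq> N"
    using ae unfolding eventually_ae_filter_negligible by blast
  obtain K where "K-lipschitz_on {x. x $ 3 \<le> m} F" using F_lipschitz by blast
  then have "K-lipschitz_on {x. x $ 3 < m} F"
    by (rule lipschitz_on_subset) auto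
  then show ?thesis
  proof (rule lipschitz_on_of_AE_derivative_le[OF open_lower_halfspace convex_lower_halfspace _ N(1)])
    fix z assume "z \<in> {x. x $ 3 < m} - N"
    then have z: "F differentiable (at z)" "onorm (frechet_derivative F (at z)) \<le> \<alpha>"
      using N(2) by (fastforce dest: less_imp_le)+
    let ?D = "frechet_derivative F (at z)"
    have D: "(F has_derivative ?D) (at z)"
      using z(1) by (simp add: frechet_derivative_works)
    have "norm (?D v) \<le> \<alpha> * norm v" for v
      using onorm[OF has_derivative_bounded_linear[OF D], of v] z(2)
      by (meson mult_right_mono norm_ge_zero order_trans)
    with D show "\<exists>D. (F has_derivative D) (at z) \<and> (\<forall>v. norm (D v) \<le> \<alpha> * norm v)" by blast
  qed (use assms in auto)
qed

text \<open>At almost every \<open>Y\<close> the derivative of the branch is the inverse of that of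
  \<open>F\<close> at the preimage, so its norm is at most \<open>\<alpha>\<close>. Since
  \<open>c \<ge> exp M\<close>, the preimages lie above height \<open>M\<close>, where
  \<open>F\<close> expands. The bound can be integrated because the half-space in the range is
  convex.\<close>

lemma branch_contracting:
  assumes ae: "AE x in lebesgue. x $ 3 \<ge> M \<longrightarrow>
      F differentiable (at x) \<and> min_stretch (frechet_derivative F (at x)) \<ge> 1 / \<alpha>"
    and \<alpha>: "\<alpha> > 0" and ev: "even (r1 + r2)" and c: "exp M \<le> c"
  shows "\<alpha>-lipschitz_on {Y. c < Y $ 3} (branch r1 r2)"
proof -
  obtain N where N: "negligible N" "{x. \<not> (x $ 3 \<ge> M \<longrightarrow>
      F differentiable (at x) \<and> min_stretch (frechet_derivative F (at x)) \<ge> 1 / \<alpha>)} \<subseteq> N"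
    using ae unfolding eventually_ae_filter_negligible by blast
  \<comment> \<open>The derivative is controlled off a null set of the domain, but the estimate
    needs an exceptional null set in the range; locally Lipschitz maps send null sets to null
    sets.\<close>
  have "negligible (F ` N)"
  proof (rule negligible_locally_Lipschitz_image[OF _ N(1)])
    fix x assume "x \<in> N"
    obtain K where K: "K-lipschitz_on {y. y $ 3 \<le> x $ 3 + 1} F" using F_lipschitz by blast
    have "norm (F y - F x) \<le> K * norm (y - x)" if "y $ 3 < x $ 3 + 1" for y
      using lipschitz_onD[OF K, of y x] that by (simp add: dist_norm)
    then show "\<exists>T B. open T \<and> x \<in> T \<and> (\<forall>y\<in>N \<inter> T. norm (F y - F x) \<le> B * norm (y - x))"
      by (intro exI[of _ "{y. y $ 3 < x $ 3 + 1}"] exI[of _ K]) (auto intro: open_lower_halfspace)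
  qed simp
  have upper: "Y $ 3 \<ge> 0" "Y \<noteq> 0" "norm Y > exp M" if "c < Y $ 3" for Y :: "real^3"
  proof -
    show "norm Y > exp M"
      using that c component_le_norm_cart[of Y 3] by linarith
    then show "Y \<noteq> 0" by auto
    show "Y $ 3 \<ge> 0"
      using that c exp_gt_zero[of M] by linarith
  qed
  obtain K where "K-lipschitz_on {Y. Y $ 3 \<ge> 0 \<and> norm Y \<ge> exp M} (branch r1 r2)"
    using branch_lipschitz[of "exp M"] by auto
  then have lip: "K-lipschitz_on {Y. c < Y $ 3} (branch r1 r2)"
    by (rule lipschitz_on_subset) (use upper in \<open>auto simp: less_imp_le\<close>)
  then show ?thesis
  proof (rule lipschitz_on_of_AE_derivative_le[OF open_upper_halfspace convex_upper_halfspace _ \<open>negligible (F ` N)\<close>])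
    fix Y assume "Y \<in> {Y. c < Y $ 3} - F ` N"
    then have Y: "c < Y $ 3" "Y \<notin> F ` N" by auto
    let ?x = "branch r1 r2 Y"
    have "F ?x = Y" by (intro F_branch upper Y ev)
    then have "?x \<notin> N" using Y by force
    moreover have "?x $ 3 \<ge> M"
      using upper[OF Y(1)] by (simp add: ln_ge_iff)
    ultimately have x: "F differentiable (at ?x)" "min_stretch (frechet_derivative F (at ?x)) \<ge> 1 / \<alpha>"
      using N(2) by blast+
    define D where "D = frechet_derivative F (at ?x)"
    have D: "(F has_derivative D) (at ?x)"
      using x(1) by (simp add: frechet_derivative_works D_def)
    then have lin: "linear D" by (rule has_derivative_linear)
    have expand: "norm v \<le> \<alpha> * norm (D v)" for v
    proof -
      have "1 / \<alpha> * norm v \<le> min_stretch D * norm v"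
        using x(2) by (intro mult_right_mono) (auto simp: D_def)
      also have "\<dots> \<le> norm (D v)" by (rule min_stretch_le[OF lin])
      finally show ?thesis using \<alpha> by (simp add: field_simps)
    qed
    then have "inj D"
      using lin by (metis linear_injective_0 mult_zero_right norm_le_zero_iff norm_zero)
    then obtain D' where D': "linear D'" "D' \<circ> D = id" "D \<circ> D' = id"
      using linear_injective_isomorphism[OF lin] by (auto simp: fun_eq_iff)
    \<comment> \<open>As \<open>D\<close> is invertible, continuity of the branch and
      \<open>F (branch r1 r2 Z) = Z\<close> near \<open>Y\<close> suffice for differentiability of
      the branch.\<close>
    have "(branch r1 r2 has_derivative D') (at Y)"
    proof (rule has_derivative_inverse_basic[where f = F and f' = D])
      show "(F has_derivative D) (at ?x)" by (rule D)
      show "D' \<circ> D = id" by (rule D'(2))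
      show "open {Y :: real^3. c < Y $ 3}" by (rule open_upper_halfspace)
      show "bounded_linear D'" using D'(1) by (simp add: linear_conv_bounded_linear)
      show "continuous (at Y) (branch r1 r2)"
        using lipschitz_on_continuous_on[OF lip] Y(1)
        by (simp add: continuous_on_eq_continuous_at[OF open_upper_halfspace])
      show "Y \<in> {Y. c < Y $ 3}" using Y by simp
      show "F (branch r1 r2 Z) = Z" if "Z \<in> {Y. c < Y $ 3}" for Z
        using that by (intro F_branch upper ev) auto
    qed
    moreover have "norm (D' v) \<le> \<alpha> * norm v" for v
      using expand[of "D' v"] D'(3) by (simp add: fun_eq_iff)
    ultimately show "\<exists>D. (branch r1 r2 has_derivative D) (at Y) \<and> (\<forall>v. norm (D v) \<le> \<alpha> * norm v)"
      by blast
  qed (use \<alpha> in auto)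
qed

end

section \<open>The dynamics above height \<open>M\<close>\<close>

locale zorich_attracting = zorich +
  fixes \<alpha> m M a :: real and \<xi> :: "real^3"
  assumes \<alpha>: "0 < \<alpha>" "\<alpha> < 1" and mM: "m < M"
    and contracting: "AE x in lebesgue. x $ 3 \<le> m \<longrightarrow>
      F differentiable (at x) \<and> onorm (frechet_derivative F (at x)) \<le> \<alpha>"
    and expanding: "AE x in lebesgue. x $ 3 \<ge> M \<longrightarrow>
      F differentiable (at x) \<and> min_stretch (frechet_derivative F (at x)) \<ge> 1 / \<alpha>"
    and a: "a \<ge> exp M - m"
    and fixed: "zorich_map h a \<xi> = \<xi>" and \<xi>_le: "\<xi> $ 3 \<le> m"
begin

abbreviation "f \<equiv> zorich_map h a"
abbreviation "J \<equiv> non_attracted f \<xi>"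

section \<open>The set \<open>J\<close> lies above height \<open>M\<close> and inside even
  beams\<close>

lemma f_nth: "f x $ 1 = F x $ 1" "f x $ 2 = F x $ 2" "f x $ 3 = F x $ 3 - a"
  by (simp_all add: zorich_map_def)

lemma f_add: "f x + vector [0, 0, a] = F x"
  by (simp add: zorich_map_def)

text \<open>Adding \<open>a\<close> to the third coordinate thus carries the half-space above height
  \<open>M\<close> into the one above \<open>exp M\<close>, where the inverse branches
  contract.\<close>

lemma exp_M_less: "exp M < M + a"
  using a mM by linarith

lemma f_below_M: "x $ 3 \<le> M \<Longrightarrow> f x $ 3 \<le> m"
  using F_3_le[of x M] a by (simp add: f_nth)

lemma f_below_m:
  assumes "x $ 3 \<le> m"
  shows "f x $ 3 < m"
proof -
  have "F x $ 3 \<le> exp m" using assms by (rule F_3_le)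
  moreover have "exp m < exp M" using mM by simp
  ultimately show ?thesis using a unfolding f_nth by linarith
qed

lemma f_contracting:
  assumes "x $ 3 < m" "y $ 3 < m"
  shows "dist (f x) (f y) \<le> \<alpha> * dist x y"
  using lipschitz_onD[OF F_contracting[OF contracting \<alpha>(1)], of x y] assms
  by (simp add: zorich_map_def dist_norm)

lemma J_iterate: "(f ^^ k) x \<in> J \<longleftrightarrow> x \<in> J"
proof (induction k arbitrary: x)
  case (Suc k)
  have "f x \<in> J \<longleftrightarrow> x \<in> J"
    using filterlim_sequentially_Suc[of "\<lambda>k. (f ^^ k) x" "nhds \<xi>"]
    by (simp add: non_attracted_def funpow_swap1)
  then show ?case using Suc[of "f x"] by (simp add: funpow_swap1)
qed simp

lemma J_f: "f x \<in> J \<longleftrightarrow> x \<in> J"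
  using J_iterate[of 1 x] by simp

text \<open>An orbit that starts at height at most \<open>M\<close> falls below \<open>m\<close>,
  stays there and is drawn geometrically to \<open>\<xi>\<close>.\<close>

lemma J_above_M:
  assumes "x \<in> J"
  shows "M < x $ 3"
proof (rule ccontr)
  assume "\<not> M < x $ 3"
  \<comment> \<open>The first iterate is only known to have height at most \<open>m\<close>; the
    second lies in the open half-space on which the contraction is available.\<close>
  define y where "y = f (f x)"
  have y3: "y $ 3 < m"
    using \<open>\<not> M < x $ 3\<close> f_below_M f_below_m by (simp add: y_def)
  have \<xi>3: "\<xi> $ 3 < m"
    using f_below_m[OF \<xi>_le] fixed by simp
  have "(f ^^ k) y $ 3 < m \<and> dist ((f ^^ k) y) \<xi> \<le> \<alpha> ^ k * dist y \<xi>" for k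
  proof (induction k)
    case (Suc k)
    have "dist (f ((f ^^ k) y)) (f \<xi>) \<le> \<alpha> * dist ((f ^^ k) y) \<xi>"
      using Suc \<xi>3 by (intro f_contracting) auto
    also have "\<dots> \<le> \<alpha> * (\<alpha> ^ k * dist y \<xi>)"
      using Suc \<alpha> by (intro mult_left_mono) auto
    finally show ?case
      using Suc fixed f_below_m[of "(f ^^ k) y"] by (simp add: mult.assoc)
  qed (simp add: y3)
  then have "\<forall>\<^sub>F k in sequentially. norm (dist ((f ^^ k) y) \<xi>) \<le> \<alpha> ^ k * dist y \<xi>"
    by simp
  moreover have "(\<lambda>k. \<alpha> ^ k * dist y \<xi>) \<longlonglongrightarrow> 0"
    using \<alpha> by (intro tendsto_mult_left_zero LIMSEQ_power_zero) auto
  ultimately have "(\<lambda>k. (f ^^ k) y) \<longlonglongrightarrow> \<xi>"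
    unfolding tendsto_dist_iff[where l = \<xi>] by (rule Lim_null_comparison)
  then have "y \<notin> J" by (simp add: non_attracted_def)
  then show False using assms by (simp add: y_def J_f)
qed

text \<open>The image \<open>f x\<close> has height \<open>- a\<close>, which is below
  \<open>M\<close> because \<open>0 < exp M < M + a\<close>.\<close>

lemma J_avoids_F_horizontal:
  assumes "F x $ 3 = 0"
  shows "x \<notin> J"
proof
  assume "x \<in> J"
  then have "M < - a" using J_above_M[of "f x"] assms by (simp add: J_f f_nth)
  then show False using exp_M_less exp_gt_zero[of M] by linarith
qed

lemma J_avoids_walls: "x $ 1 = 2 * of_int k + 1 \<Longrightarrow> x \<notin> J"
  using F_3_eq_0[of x k] J_avoids_F_horizontal by blast

section \<open>Inverse branches of the dynamics along an orbit in \<open>J\<close>\<close>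

definition b1 :: "real^3 \<Rightarrow> int" where "b1 x = beam_index (x $ 1)"
definition b2 :: "real^3 \<Rightarrow> int" where "b2 x = beam_index (x $ 2)"

lemma in_own_beam: "x \<in> beam (b1 x) (b2 x)"
  using abs_minus_beam_index by (simp add: beam_def b1_def b2_def)

text \<open>\<open>F\<close> sends odd beams to the closed lower half-space, so there
  \<open>f x\<close> has height at most \<open>- a\<close>, too low for \<open>J\<close>.\<close>

lemma even_beam:
  assumes "x \<in> J"
  shows "even (b1 x + b2 x)"
proof (rule ccontr)
  assume "odd (b1 x + b2 x)"
  then have "sheet_sign x = -1"
    by (simp add: sheet_sign_def power_int_minus_left b1_def b2_def)
  moreover have "h (fold_point x) $ 3 \<ge> 0"
    using h_fold_point[of x] by (simp add: upper_hemisphere_def)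
  ultimately have "F x $ 3 \<le> 0"
    by (simp add: F_nth)
  moreover have "M < F x $ 3 - a"
    using J_above_M[of "f x"] assms by (simp add: J_f f_nth)
  ultimately show False using exp_M_less exp_gt_zero[of M] by linarith
qed

text \<open>For \<open>x\<close> in \<open>J\<close> this is the inverse branch of \<open>f\<close>
  that carries \<open>f x\<close> back to \<open>x\<close>; the beam is fixed by \<open>x\<close>,
  while \<open>y\<close> ranges over the half-space above \<open>M\<close>.\<close>

definition pull :: "real^3 \<Rightarrow> real^3 \<Rightarrow> real^3" where
  "pull x y = branch (b1 x) (b2 x) (y + vector [0, 0, a])"

lemma shifted_above:
  fixes y :: "real^3"
  assumes "M < y $ 3"
  shows "(y + vector [0, 0, a]) $ 3 \<ge> 0" "y + vector [0, 0, a] \<noteq> 0"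
    "norm (y + vector [0, 0, a]) > exp M"
proof -
  show "norm (y + vector [0, 0, a]) > exp M"
    using assms exp_M_less component_le_norm_cart[of "y + vector [0, 0, a]" 3] by simp
  then show "y + vector [0, 0, a] \<noteq> 0" by (metis exp_gt_zero norm_zero not_less_iff_gr_or_eq)
  show "(y + vector [0, 0, a]) $ 3 \<ge> 0"
    using assms exp_M_less exp_gt_zero[of M] unfolding component_3_add_vector by linarith
qed

lemma pull_above:
  assumes "M < y $ 3"
  shows "M < pull x y $ 3"
  using shifted_above[OF assms] by (simp add: pull_def less_ln_of_exp_less)

lemma f_pull:
  assumes "x \<in> J" "M < y $ 3"
  shows "f (pull x y) = y"
  using F_branch[OF shifted_above(1,2)[OF assms(2)] even_beam[OF assms(1)]]
  by (simp add: zorich_map_def pull_def)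

lemma pull_f:
  assumes "x \<in> J"
  shows "pull x (f x) = x"
  using branch_F[OF in_own_beam even_beam[OF assms]] by (simp add: pull_def f_add)

lemma pull_lipschitz:
  assumes "x \<in> J"
  shows "\<alpha>-lipschitz_on {y. M < y $ 3} (pull x)"
proof (rule lipschitz_onI)
  fix y z :: "real^3" assume "y \<in> {y. M < y $ 3}" "z \<in> {y. M < y $ 3}"
  then show "dist (pull x y) (pull x z) \<le> \<alpha> * dist y z"
    using lipschitz_onD[OF branch_contracting[OF expanding \<alpha>(1) even_beam[OF assms] less_imp_le[OF exp_M_less]],
        of "y + vector [0, 0, a]" "z + vector [0, 0, a]"]
    by (simp add: pull_def)
qed (use \<alpha> in simp)

text \<open>For \<open>x\<close> in \<open>J\<close> this is the branch of the inverse of the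
  \<open>k\<close>-th iterate that follows the orbit of \<open>x\<close> backwards. Placing the
  newest branch innermost makes consecutive curves of the chain meet.\<close>

primrec pulls :: "real^3 \<Rightarrow> nat \<Rightarrow> real^3 \<Rightarrow> real^3" where
  "pulls x 0 y = y"
| "pulls x (Suc k) y = pulls x k (pull ((f ^^ k) x) y)"

text \<open>By \<open>pull_above\<close> each branch keeps the half-space above \<open>M\<close>
  invariant, so the factors \<open>\<alpha>\<close> multiply.\<close>

lemma pulls_lipschitz:
  assumes "x \<in> J"
  shows "(\<alpha> ^ k)-lipschitz_on {y. M < y $ 3} (pulls x k)"
proof (induction k)
  case 0
  show ?case by (rule lipschitz_onI) auto
next
  case (Suc k)
  have "\<alpha>-lipschitz_on {y. M < y $ 3} (pull ((f ^^ k) x))"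
    using assms by (intro pull_lipschitz) (simp add: J_iterate)
  moreover have "(\<alpha> ^ k)-lipschitz_on (pull ((f ^^ k) x) ` {y. M < y $ 3}) (pulls x k)"
    using Suc by (rule lipschitz_on_subset) (auto intro: pull_above)
  ultimately show ?case
    using lipschitz_on_compose2 by (fastforce simp: mult.commute)
qed

lemma iterate_pulls:
  assumes "x \<in> J" "M < y $ 3"
  shows "(f ^^ k) (pulls x k y) = y"
  using assms(2)
proof (induction k arbitrary: y)
  case (Suc k)
  then show ?case
    using assms(1) by (simp add: pull_above f_pull J_iterate)
qed simp

lemma pulls_iterate:
  assumes "x \<in> J"
  shows "pulls x k ((f ^^ k) x) = x"
proof (induction k)
  case (Suc k)
  then show ?case using assms pull_f[of "(f ^^ k) x"] by (simp add: J_iterate)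
qed simp

section \<open>Curves outside \<open>J\<close> between walls, and their pullbacks\<close>

definition wall :: "real^3 \<Rightarrow> real^3" where
  "wall x = vector [2 * of_int (b1 x) + 1, x $ 2, x $ 3]"

lemma wall_nth [simp]: "wall x $ 1 = 2 * of_int (b1 x) + 1" "wall x $ 2 = x $ 2" "wall x $ 3 = x $ 3"
  by (simp_all add: wall_def)

lemma wall_in_beam: "wall x \<in> beam (b1 x) (b2 x)"
  using in_own_beam[of x] by (simp add: beam_def)

lemma dist_wall_le: "dist (wall x) x \<le> 2"
  using norm_le_abs_3[of "wall x - x"] beam_width(1)[OF wall_in_beam in_own_beam, of x]
  by (simp add: dist_norm)

lemma wall_connection:
  assumes x: "x \<in> J"
  shows "\<exists>p. path p \<and> pathstart p = wall x \<and> pathfinish p = pull x (wall (f x)) \<and>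
    path_image p \<subseteq> {w. M < w $ 3} - J \<and> path_image p \<subseteq> cball x (4 + 2 / exp M)"
proof -
  have fx: "f x \<in> J" using x by (simp add: J_f)
  define Y where "Y = wall (f x) + vector [0, 0, a]"
  have above: "M < wall (f x) $ 3" using J_above_M[OF fx] by simp
  have Y: "Y $ 1 = 2 * of_int (b1 (f x)) + 1" "Y $ 3 > 0" "norm Y > exp M"
  proof -
    show "Y $ 1 = 2 * of_int (b1 (f x)) + 1" by (simp add: Y_def)
    show "norm Y > exp M" using shifted_above(3)[OF above] by (simp add: Y_def)
    show "Y $ 3 > 0"
      unfolding Y_def component_3_add_vector using above exp_M_less exp_gt_zero[of M] by linarith
  qed
  have Fx: "exp M < norm (F x)"
    using J_above_M[OF x] by (simp add: norm_F)
  \<comment> \<open>The interval from \<open>lo\<close> to \<open>hi\<close> contains the logarithms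
    of the norms of both \<open>Y\<close> and \<open>F (wall x)\<close>, since \<open>wall\<close>
    keeps the height.\<close>
  define lo hi where "lo = min (ln (norm Y)) (x $ 3)" and "hi = max (ln (norm Y)) (x $ 3)"
  have "M < ln (norm Y)" using Y(3) by (rule less_ln_of_exp_less)
  then have lo: "M < lo" using J_above_M[OF x] by (simp add: lo_def)
  \<comment> \<open>\<open>Y\<close> and \<open>F x\<close> are at distance at most 2 and have norms
    above \<open>exp M\<close>, where the logarithm has Lipschitz constant \<open>1 / exp M\<close>.
    This bounds the vertical extent of the lifted curve.\<close>
  have height: "\<bar>t - x $ 3\<bar> \<le> 2 / exp M" if "t \<in> {lo..hi}" for t
  proof -
    have "Y - F x = wall (f x) - f x" by (simp add: Y_def zorich_map_def)
    then have "\<bar>norm Y - norm (F x)\<bar> \<le> 2"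
      using norm_triangle_ineq3[of Y "F x"] dist_wall_le[of "f x"] by (simp add: dist_norm)
    then have "\<bar>norm Y - norm (F x)\<bar> / exp M \<le> 2 / exp M"
      by (intro divide_right_mono) auto
    moreover have "\<bar>ln (norm Y) - ln (norm (F x))\<bar> \<le> \<bar>norm Y - norm (F x)\<bar> / exp M"
      using Y(3) Fx by (intro abs_ln_diff_le) auto
    ultimately have "\<bar>ln (norm Y) - x $ 3\<bar> \<le> 2 / exp M" by (simp add: norm_F)
    then show ?thesis using that by (auto simp: lo_def hi_def)
  qed

  obtain E where conn: "path_connected E" and "Y \<in> E"
    and horiz: "\<And>Z. Z \<noteq> 0 \<Longrightarrow> Z $ 3 = 0 \<Longrightarrow> ln (norm Z) \<in> {lo..hi} \<Longrightarrow> Z \<in> E"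
    and E: "\<And>Z. Z \<in> E \<Longrightarrow> Z \<noteq> 0 \<and> Z $ 3 \<ge> 0 \<and> (Z $ 1 = Y $ 1 \<or> Z $ 3 = 0) \<and> ln (norm Z) \<in> {lo..hi}"
    using path_connected_arc_annulus[of Y lo hi] Y(2) by (auto simp: lo_def hi_def)
  have "F (wall x) \<in> E"
  proof (rule horiz)
    show "F (wall x) \<noteq> 0" using norm_F[of "wall x"] by (metis exp_not_eq_zero norm_zero)
    show "F (wall x) $ 3 = 0" by (rule F_3_eq_0[of _ "b1 x"]) simp
    show "ln (norm (F (wall x))) \<in> {lo..hi}" by (simp add: norm_F lo_def hi_def)
  qed
  have E_norm: "norm Z > exp M" if "Z \<in> E" for Z
  proof -
    have "norm Z > 0" "M < ln (norm Z)" using E[OF that] lo by auto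
    then show ?thesis by (metis exp_less_cancel_iff exp_ln)
  qed
  define B where "B = branch (b1 x) (b2 x)"
  obtain K where "K-lipschitz_on {Z. Z $ 3 \<ge> 0 \<and> norm Z \<ge> exp M} B"
    using branch_lipschitz[of "exp M"] unfolding B_def by auto
  then have "continuous_on E B"
    by (intro continuous_on_subset[OF lipschitz_on_continuous_on]) (use E E_norm in \<open>auto simp: less_imp_le\<close>)
  then have "path_connected (B ` E)"
    using conn by (rule path_connected_continuous_image)
  moreover have "B (F (wall x)) = wall x"
    unfolding B_def by (intro branch_F wall_in_beam even_beam x)
  then have "wall x \<in> B ` E"
    using \<open>F (wall x) \<in> E\<close> by force
  moreover have "pull x (wall (f x)) \<in> B ` E"
    using \<open>Y \<in> E\<close> by (auto simp: pull_def B_def Y_def)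
  ultimately obtain p where p: "path p" "path_image p \<subseteq> B ` E"
    "pathstart p = wall x" "pathfinish p = pull x (wall (f x))"
    unfolding path_connected_def by blast
  \<comment> \<open>In the radius each horizontal coordinate contributes the beam width 2, and the
    height contributes \<open>2 / exp M\<close>.\<close>
  have "M < B Z $ 3 \<and> B Z \<notin> J \<and> dist x (B Z) \<le> 4 + 2 / exp M" if "Z \<in> E" for Z
  proof (intro conjI)
    note Z = E[OF that]
    then have nz: "Z $ 3 \<ge> 0" "Z \<noteq> 0" by auto
    show "M < B Z $ 3" using Z lo by (simp add: B_def)
    have FB: "F (B Z) = Z"
      unfolding B_def by (intro F_branch nz even_beam x)
    \<comment> \<open>On the planar piece \<open>F (B Z)\<close> has height 0; on the arc
      \<open>f (B Z)\<close> lies on a wall of the beam of \<open>f x\<close> and is attracted,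
      which passes back to \<open>B Z\<close> by invariance of \<open>J\<close>.\<close>
    show "B Z \<notin> J"
    proof (cases "Z $ 3 = 0")
      case True
      then show ?thesis using FB by (intro J_avoids_F_horizontal) simp
    next
      case False
      then have "f (B Z) $ 1 = 2 * of_int (b1 (f x)) + 1" using Z FB Y(1) by (simp add: f_nth)
      then show ?thesis using J_avoids_walls J_f by blast
    qed
    have "B Z \<in> beam (b1 x) (b2 x)"
      unfolding B_def using nz by (rule branch_in_beam)
    then have "\<bar>x $ 1 - B Z $ 1\<bar> \<le> 2" "\<bar>x $ 2 - B Z $ 2\<bar> \<le> 2"
      using beam_width[OF in_own_beam] by blast+
    moreover have "\<bar>x $ 3 - B Z $ 3\<bar> \<le> 2 / exp M"
      using height[of "ln (norm Z)"] Z by (simp add: B_def abs_minus_commute)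
    ultimately show "dist x (B Z) \<le> 4 + 2 / exp M"
      using norm_le_abs_3[of "x - B Z"] by (simp add: dist_norm)
  qed
  then have "B ` E \<subseteq> ({w. M < w $ 3} - J) \<inter> cball x (4 + 2 / exp M)"
    by auto
  then show ?thesis using p by blast
qed

lemma J_accessible:
  assumes x: "x \<in> J"
  shows "accessible_from (- J) x"
proof -
  have xk: "(f ^^ k) x \<in> J" for k using x by (simp add: J_iterate)
  let ?H = "{w. M < w $ 3} :: (real^3) set"
  define C where "C = 4 + 2 / exp M"
  obtain p where p: "\<And>k. path (p k)" "\<And>k. pathstart (p k) = wall ((f ^^ k) x)"
    "\<And>k. pathfinish (p k) = pull ((f ^^ k) x) (wall ((f ^^ Suc k) x))"
    "\<And>k. path_image (p k) \<subseteq> ?H - J" "\<And>k. path_image (p k) \<subseteq> cball ((f ^^ k) x) C"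
    using wall_connection[OF xk] unfolding C_def funpow.simps comp_def by metis
  define P where "P k = pulls x k \<circ> p k" for k
  note lip = pulls_lipschitz[OF x]
  have img: "path_image (P k) = pulls x k ` path_image (p k)" for k
    by (simp add: P_def path_image_compose)
  show ?thesis
  proof (rule accessible_from_chain)
    fix k
    show "path (P k)"
      unfolding P_def using p(4)[of k]
      by (intro path_continuous_image p(1) continuous_on_subset[OF lipschitz_on_continuous_on[OF lip]]) blast
    \<comment> \<open>Both points are \<open>pulls x k\<close> applied to the pulled back wall point
      of the next iterate.\<close>
    show "pathfinish (P k) = pathstart (P (Suc k))"
      by (simp add: P_def pathfinish_compose pathstart_compose p(2,3))
    show "path_image (P k) \<subseteq> - J"
    proof -
      have "pulls x k w \<notin> J" if "w \<in> path_image (p k)" for w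
      proof -
        have "M < w $ 3" "w \<notin> J" using that p(4)[of k] by auto
        then show ?thesis using iterate_pulls[OF x] J_iterate[of k "pulls x k w"] by metis
      qed
      then show ?thesis by (auto simp: img)
    qed
    show "path_image (P k) \<subseteq> cball x (\<alpha> ^ k * C)"
    proof -
      have "dist x (pulls x k w) \<le> \<alpha> ^ k * C" if w: "w \<in> path_image (p k)" for w
      proof -
        \<comment> \<open>\<open>pulls x k\<close> returns the \<open>k\<close>-th iterate to
          \<open>x\<close>, and \<open>C\<close> does not depend on \<open>k\<close>, so the pulled
          back curves shrink to \<open>x\<close>.\<close>
        have "dist (pulls x k ((f ^^ k) x)) (pulls x k w) \<le> \<alpha> ^ k * dist ((f ^^ k) x) w"
          using w p(4)[of k] J_above_M[OF xk[of k]] by (intro lipschitz_onD[OF lip]) auto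
        also have "\<dots> \<le> \<alpha> ^ k * C"
          using w p(5)[of k] \<alpha> by (intro mult_left_mono) auto
        finally show ?thesis by (simp add: pulls_iterate[OF x])
      qed
      then show ?thesis by (auto simp: img)
    qed
  next
    show "(\<lambda>k. \<alpha> ^ k * C) \<longlonglongrightarrow> 0"
      using \<alpha> by (intro tendsto_mult_left_zero LIMSEQ_power_zero) auto
  qed
qed

end

theorem theorem2:
  fixes h :: "real^2 \<Rightarrow> real^3" and \<alpha> m M a :: real and \<xi> :: "real^3"
  assumes "bilipschitz_on square h" and "h ` square = upper_hemisphere"
    and "0 < \<alpha>" and "\<alpha> < 1" and "m < M"
    and "AE x in lebesgue. x $ 3 \<le> m \<longrightarrow>
           zorich_F h differentiable (at x) \<and>
           onorm (frechet_derivative (zorich_F h) (at x)) \<le> \<alpha>"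
    and "AE x in lebesgue. x $ 3 \<ge> M \<longrightarrow>
           zorich_F h differentiable (at x) \<and>
           min_stretch (frechet_derivative (zorich_F h) (at x)) \<ge> 1 / \<alpha>"
    and "a \<ge> exp M - m"
    and "zorich_map h a \<xi> = \<xi>" and "\<xi> $ 3 \<le> m"
  shows "\<forall>x \<in> non_attracted (zorich_map h a) \<xi>.
           accessible_from (- non_attracted (zorich_map h a) \<xi>) x"
proof -
  interpret zorich_attracting h \<alpha> m M a \<xi>
    using assms by unfold_locales
  show ?thesis using J_accessible by blast
qed

end
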